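(* Let $n\ge 2$ be an integer and $d=n-1$. The following two statements are equivalent. (a) For every zonoid $A\subset\mathbb R^n$, $$\mathrm{vol}(A)\,\mathrm{vol}(P_{\{n\}}A)^{n-2}\ \le\ \prod_{\ell=1}^{n-1}\mathrm{vol}(P_{\{\ell,n\}}A).$$ (b) For all nonnegative reals $(x_v)_{v\in\{0,1\}^d}$, $$\Bigl(\sum_{S\in\binom{\{0,1\}^d}{d+1}}\mathrm{Vol}(S)\prod_{v\in S}x_v\Bigr)\Bigl(\sum_{v\in\{0,1\}^d}x_v\Bigr)^{d-1}\ \le\ \prod_{\substack{F\subset[0,1]^d\\ F\ \text{facet}}}\ \sum_{v\in F\cap\{0,1\}^d}x_v .$$
   Context: A zonotope is a Minkowski sum of finitely many line segments; a zonoid is a limit of zonotopes in the Hausdorff metric. For $I\subseteq\{1,\dots,n\}$, $P_I$ is the orthogonal projection of $\mathbb R^n$ onto the coordinate subspace spanned by $e_i$, $i\in I$, and $\mathrm{vol}(P_IA)$ is the $|I|$-dimensional volume of $P_IA$ in that subspace. $\binom{\{0,1\}^d}{d+1}$ is the set of all $(d+1)$-element subsets of $\{0,1\}^d$, and $\mathrm{Vol}(S)=d!\,\mathrm{vol}(\mathrm{conv}(S))$ is the normalized $d$-dimensional volume of the convex hull of $S$ (zero if $S$ is affinely dependent). The product on the right of (b) runs over all $2d$ facets of the cube $[0,1]^d$. Inequality (b) is called the Hypercube inequality. *)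

theory Defs
  imports "HOL-Analysis.Analysis"
begin

text \<open>Addition and finite sums of sets are Minkowski sums (\<open>HOL-Library.Set_Algebras\<close>).\<close>

definition zonotope :: "'a::euclidean_space set \<Rightarrow> bool" where
  "zonotope Z \<longleftrightarrow> (\<exists>(m::nat) a b. Z = (\<Sum>i<m. closed_segment (a i) (b i)))"

text \<open>Only meaningful for nonempty bounded sets, since the suprema are taken in the reals.\<close>

definition hausdorff_dist :: "'a::metric_space set \<Rightarrow> 'a set \<Rightarrow> real" where
  "hausdorff_dist A B = max (SUP x\<in>A. infdist x B) (SUP y\<in>B. infdist y A)"

text \<open>The Hausdorff metric lives on the nonempty compact sets, so a limit is required to be one.\<close>

definition zonoid :: "'a::euclidean_space set \<Rightarrow> bool" where
  "zonoid A \<longleftrightarrow> compact A \<and> A \<noteq> {} \<and>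
     (\<exists>Z. (\<forall>k::nat. zonotope (Z k)) \<and> (\<lambda>k. hausdorff_dist (Z k) A) \<longlonglongrightarrow> 0)"

definition coord_proj :: "'n set \<Rightarrow> real ^ 'n \<Rightarrow> real ^ 'n::finite" where
  "coord_proj I x = (\<chi> i. if i \<in> I then x $ i else 0)"

text \<open>The \<open>card I\<close>-dimensional volume of a subset of the coordinate subspace spanned by the
  axes in \<open>I\<close>: that subspace is identified with the functions on \<open>I\<close>, carrying the product
  of the Lebesgue measures on the line.\<close>

definition coord_vol :: "'n set \<Rightarrow> (real ^ 'n::finite) set \<Rightarrow> real" where
  "coord_vol I B = measure (Pi\<^sub>M I (\<lambda>_. lborel)) ((\<lambda>x. \<lambda>i\<in>I. x $ i) ` B)"

definition cube_vertices :: "(real ^ 'd::finite) set" where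
  "cube_vertices = {v. \<forall>i. v $ i \<in> {0, 1}}"

definition normalized_vol :: "(real ^ 'd::finite) set \<Rightarrow> real" where
  "normalized_vol S = fact CARD('d) * measure lebesgue (convex hull S)"

end

theory Submission
  imports Defs
begin

text \<open>
  For a convex body \<open>K\<close> the volume of \<open>K + [0, t u]\<close> is affine in \<open>t \<ge> 0\<close>, so the volume of a
  zonotope \<open>\<Sum>i. [0, t\<^sub>i u\<^sub>i]\<close> is a multi-affine homogeneous polynomial in the \<open>t\<^sub>i\<close>, whose coefficients
  are volumes of parallelepipeds: \<open>vol Z = \<Sum>S. \<bar>det u\<^sub>S\<bar>\<close>, and likewise for the coordinate projections.
  With \<open>u\<^sub>i = y\<^sub>i (w\<^sub>i, 1)\<close> the inequality (a) compares \<open>\<Sum>S. y\<^sub>S Vol(w\<^sub>S)\<close> with the product over the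
  coordinates \<open>l\<close> of \<open>\<Sum>i<j. y\<^sub>i y\<^sub>j \<bar>w\<^sub>i\<^sub>l - w\<^sub>j\<^sub>l\<bar>\<close>. If all \<open>w\<^sub>i\<close> are vertices of the cube this is exactly
  (b). Conversely, as a function of the \<open>l\<close>-th coordinates alone the left-hand side is a seminorm,
  while the right-hand side is additive when a function is decomposed into indicators of its
  superlevel sets; so the inequality passes from 0/1-valued to arbitrary coordinates, one coordinate
  at a time. Generators with last coordinate 0 and general zonoids follow by continuity.
\<close>

section \<open>Linear images and simplices in arbitrary finite index types\<close>

text \<open>Projections to different numbers of axes would each call for their own affinity and
  determinant argument. Adding a unit cube in the missing axes makes all of them full-dimensional
  volumes, so one argument serves for volume, areas and width. Sums over subsets are handled as sums
  over all tuples in \<open>UNIV \<rightarrow>\<^sub>E M\<close>: tuples with a repetition have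
  determinant 0, no subset has to be ordered, and generators over the same point merge by expanding
  a product of sums. The price is a factor (d + 1)! on the volume and a factor 2 on each of the d
  areas; this is the origin of the constants \<open>fact (CARD('d) + 1)\<close> and
  \<open>2 ^ CARD('d)\<close>. The coordinatewise descent works because the l-th coordinates enter
  the left-hand side only through one row of each determinant and the right-hand side only through
  its l-th factor, while the power of the total weight does not see them at all. A generator with
  last coordinate 0 corresponds to no point w, which is why the inequality is also kept in a form
  without division.\<close>

lemma lborel_vec_reindex:
  fixes b :: "'m::finite \<Rightarrow> 'n::finite"
  assumes b: "bij b"
  shows "distr lborel borel (\<lambda>x::real^'n. (\<chi> i. x $ b i) :: real^'m) = lborel"
proof (rule lborel_eqI[symmetric])
  let ?h = "\<lambda>x::real^'n. (\<chi> i. x $ b i) :: real^'m"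
  let ?k = "\<lambda>x::real^'m. (\<chi> i. x $ inv b i) :: real^'n"
  fix l u :: "real^'m" assume le: "\<And>c. c \<in> Basis \<Longrightarrow> l \<bullet> c \<le> u \<bullet> c"
  have le': "l $ i \<le> u $ i" for i
    using le[of "axis i 1"] by (simp add: inner_axis axis_in_Basis_iff)
  have meas: "?h \<in> borel_measurable borel"
    by (intro borel_measurable_continuous_onI continuous_intros)
  have vimage: "?h -` box l u = box (?k l) (?k u)"
    using b by (auto simp: mem_box_cart bij_betw_def) (metis inv_f_f surj_f_inv_f)+
  have "emeasure (distr lborel borel ?h) (box l u) = emeasure lborel (box (?k l) (?k u))"
    using meas by (simp add: emeasure_distr vimage)
  also have "\<dots> = (\<Prod>c\<in>Basis. (?k u - ?k l) \<bullet> c)"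
    using le' by (intro emeasure_lborel_box) (auto simp: Basis_vec_def inner_axis)
  also have "(\<Prod>c\<in>Basis. (?k u - ?k l) \<bullet> c) = (\<Prod>i\<in>UNIV. u $ inv b i - l $ inv b i)"
    by (simp add: Basis_vec_def UNION_singleton_eq_range prod.reindex inj_on_def axis_eq_axis inner_axis)
  also have "\<dots> = (\<Prod>i\<in>UNIV. u $ i - l $ i)"
    using bij_imp_bij_inv[OF b] by (rule prod.reindex_bij_betw)
  also have "\<dots> = (\<Prod>c\<in>Basis. (u - l) \<bullet> c)"
    by (simp add: Basis_vec_def UNION_singleton_eq_range prod.reindex inj_on_def axis_eq_axis inner_axis)
  finally show "emeasure (distr lborel borel ?h) (box l u) = (\<Prod>c\<in>Basis. (u - l) \<bullet> c)" .
qed simp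

lemma measure_vec_reindex:
  fixes b :: "'m::finite \<Rightarrow> 'n::finite" and S :: "(real^'n) set"
  assumes b: "bij b" and S: "compact S"
  shows "measure lebesgue ((\<lambda>x. (\<chi> i. x $ b i) :: real^'m) ` S) = measure lebesgue S"
proof -
  let ?h = "\<lambda>x::real^'n. (\<chi> i. x $ b i) :: real^'m"
  have meas: "?h \<in> borel_measurable borel"
    by (intro borel_measurable_continuous_onI continuous_intros)
  have "compact (?h ` S)"
    by (intro compact_continuous_image S continuous_intros)
  then have hS: "?h ` S \<in> sets borel" by (simp add: compact_imp_closed)
  have inj: "inj ?h"
    using b by (auto simp: inj_on_def vec_eq_iff bij_def surj_def) metis
  have "measure lborel (?h ` S) = measure (distr lborel borel ?h) (?h ` S)"
    by (simp add: lborel_vec_reindex[OF b])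
  also have "\<dots> = measure lborel (?h -` ?h ` S)"
    using meas hS by (simp add: measure_distr)
  also have "?h -` ?h ` S = S" using inj by (rule inj_vimage_image_eq)
  finally show ?thesis
    using hS S by (simp add: measure_completion compact_imp_closed)
qed

section \<open>Determinants under renaming of indices\<close>

lemma bij_betw_map_permutation:
  assumes f: "bij_betw f A B"
  shows "bij_betw (map_permutation A f) {p. p permutes A} {q. q permutes B}"
proof (rule bij_betw_byWitness[where f'="map_permutation B (inv_into A f)"])
  have inv: "bij_betw (inv_into A f) B A" by (rule bij_betw_inv_into[OF f])
  show "\<forall>p\<in>{p. p permutes A}. map_permutation B (inv_into A f) (map_permutation A f p) = p"
    using f by (auto intro: map_permutation_compose_inv bij_betw_inv_into_left)
  show "\<forall>q\<in>{q. q permutes B}. map_permutation A f (map_permutation B (inv_into A f) q) = q"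
    using inv f by (auto intro: map_permutation_compose_inv bij_betw_inv_into_right)
  show "map_permutation A f ` {p. p permutes A} \<subseteq> {q. q permutes B}"
    using map_permutation_permutes[OF f] by auto
  show "map_permutation B (inv_into A f) ` {q. q permutes B} \<subseteq> {p. p permutes A}"
    using map_permutation_permutes[OF inv] by auto
qed

text \<open>Conjugation by \<open>b\<close> is a bijection between the permutations that preserves
  signs. Sets are used in place of whole types because \<open>det_homog\<close> applies it to the
  permutations of \<open>range Some\<close>.\<close>

lemma sum_permutations_reindex:
  fixes A :: "'n \<Rightarrow> 'n \<Rightarrow> 'a::comm_ring_1"
  assumes b: "bij_betw b S T" and S: "finite S"
  shows "(\<Sum>p | p permutes T. of_int (sign p) * (\<Prod>i\<in>T. A i (p i)))
    = (\<Sum>p | p permutes S. of_int (sign p) * (\<Prod>i\<in>S. A (b i) (b (p i))))"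
proof -
  have inj: "inj_on b S" using b by (simp add: bij_betw_def)
  have "of_int (sign (map_permutation S b p)) * (\<Prod>i\<in>T. A i (map_permutation S b p i))
      = of_int (sign p) * (\<Prod>i\<in>S. A (b i) (b (p i)))" if p: "p permutes S" for p
    using prod.reindex_bij_betw[OF b, of "\<lambda>i. A i (map_permutation S b p i)"]
    by (simp add: sign_map_permutation[OF inj p S] map_permutation_apply[OF inj])
  then show ?thesis
    by (subst sum.reindex_bij_betw[OF bij_betw_map_permutation[OF b], symmetric]) simp
qed

lemma det_reindex:
  fixes b :: "'m::finite \<Rightarrow> 'n::finite" and A :: "'a::comm_ring_1^'n^'n"
  assumes b: "bij b"
  shows "det (\<chi> i j. A $ b i $ b j) = det A"
  using sum_permutations_reindex[OF b finite, of "\<lambda>i j. A $ i $ j"] by (simp add: det_def)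

text \<open>The change of variables theorem and the volume of a simplex are available in
  HOL-Analysis only for well-ordered index types, hence a well-ordered copy of the index type.\<close>

datatype 'a wo = WO (unwo: 'a)

lemma bij_unwo: "bij unwo"
  by (rule bij_betwI[where g=WO]) auto

instance wo :: (finite) finite
proof
  show "finite (UNIV :: 'a wo set)"
    using bij_betw_finite[OF bij_unwo[where 'a='a]] by simp
qed

lemma card_wo: "CARD('a wo) = CARD('a)"
  using bij_betw_same_card[OF bij_unwo] .

text \<open>An arbitrary injection into the naturals, since any well-order on the copy will
  do.\<close>

definition wo_rank :: "'a::finite \<Rightarrow> nat" where
  "wo_rank = (SOME f. inj f)"

lemma inj_wo_rank: "inj wo_rank"
proof -
  have "\<exists>f::'a\<Rightarrow>nat. inj f"
    using finite_imp_inj_to_nat_seg[of "UNIV::'a set"] by auto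
  then show ?thesis unfolding wo_rank_def by (rule someI_ex)
qed

instantiation wo :: (finite) wellorder
begin

definition "x \<le> y \<longleftrightarrow> wo_rank (unwo x) \<le> wo_rank (unwo y)"
definition "x < y \<longleftrightarrow> wo_rank (unwo x) < wo_rank (unwo y)"

instance
proof
  fix x y :: "'a wo"
  show "x \<le> y \<Longrightarrow> y \<le> x \<Longrightarrow> x = y"
    using inj_wo_rank by (cases x; cases y) (auto simp: less_eq_wo_def dest: injD)
next
  fix P :: "'a wo \<Rightarrow> bool" and a :: "'a wo"
  assume "\<And>x. (\<And>y. y < x \<Longrightarrow> P y) \<Longrightarrow> P x"
  then show "P a"
    unfolding less_wo_def by (induction a rule: measure_induct_rule[of "\<lambda>x. wo_rank (unwo x)"]) auto
qed (auto simp: less_eq_wo_def less_wo_def)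

end

text \<open>Conjugating \<open>f\<close> with the renaming of coordinates moves the claim to the
  well-ordered copy. Renaming preserves volumes, and the determinant survives because rows and
  columns are permuted simultaneously.\<close>

lemma measure_linear_image_finite:
  fixes f :: "real^'n \<Rightarrow> real^'n::finite"
  assumes f: "linear f" and S: "compact S"
  shows "measure lebesgue (f ` S) = \<bar>det (matrix f)\<bar> * measure lebesgue S"
proof -
  let ?h = "\<lambda>x::real^'n. (\<chi> i. x $ unwo i) :: real^'n wo"
  let ?k = "\<lambda>x::real^'n wo. (\<chi> i. x $ WO i) :: real^'n"
  define g where "g = ?h \<circ> f \<circ> ?k"
  have kh: "?k (?h x) = x" for x by (simp add: vec_eq_iff)
  have lin: "linear g"
    unfolding g_def
    by (intro linear_compose f) (auto intro!: linearI simp: vec_eq_iff)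
  have fS: "compact (f ` S)" by (intro compact_continuous_image S linear_continuous_on_compose[OF continuous_on_id f, simplified])
  have hS: "compact (?h ` S)"
    by (intro compact_continuous_image S continuous_intros)
  have "measure lebesgue (f ` S) = measure lebesgue (?h ` f ` S)"
    by (rule measure_vec_reindex[OF bij_unwo fS, symmetric])
  also have "?h ` f ` S = g ` ?h ` S"
    by (simp add: g_def image_image kh)
  also have "measure lebesgue (g ` ?h ` S) = \<bar>det (matrix g)\<bar> * measure lebesgue (?h ` S)"
    using hS by (intro measure_linear_image lin lmeasurable_compact)
  also have "measure lebesgue (?h ` S) = measure lebesgue S"
    by (rule measure_vec_reindex[OF bij_unwo S])
  also have "matrix g = (\<chi> i j. matrix f $ unwo i $ unwo j)"
  proof -
    have "?k (axis j 1) = axis (unwo j) 1" for j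
      by (auto simp: vec_eq_iff axis_def)
    then show ?thesis by (simp add: matrix_def g_def vec_eq_iff)
  qed
  also have "det \<dots> = det (matrix f)" by (rule det_reindex[OF bij_unwo])
  finally show ?thesis .
qed

lemma measure_simplex_finite:
  fixes X :: "(real ^ 'n::finite) set" and f :: "'n \<Rightarrow> real ^ 'n"
  assumes X: "finite X" "card X = Suc CARD('n)" "x0 \<in> X" and f: "bij_betw f UNIV (X - {x0})"
  shows "measure lebesgue (convex hull X) = \<bar>det (\<chi> i j. f j $ i - x0 $ i)\<bar> / fact CARD('n)"
proof -
  let ?h = "\<lambda>x::real^'n. (\<chi> i. x $ unwo i) :: real^'n wo"
  have lin: "linear ?h" by (auto intro!: linearI simp: vec_eq_iff)
  have inj: "inj ?h"
    by (rule injI) (metis vec_lambda_beta vec_eq_iff wo.sel)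
  have "measure lebesgue (convex hull X) = measure lebesgue (?h ` (convex hull X))"
    by (rule measure_vec_reindex[OF bij_unwo, symmetric]) (simp add: X finite_imp_compact_convex_hull)
  also have "\<dots> = measure lebesgue (convex hull (?h ` X))"
    by (simp add: convex_hull_linear_image[OF lin])
  also have "\<dots> = measure lborel (convex hull (?h ` X))"
    by (rule measure_completion) (simp add: X finite_imp_compact_convex_hull borel_compact)
  also have "\<dots> = \<bar>det (\<chi> i j. (?h \<circ> f \<circ> unwo) j $ i - ?h x0 $ i)\<bar> / fact CARD('n wo)"
  proof (rule content_simplex)
    show "card (?h ` X) = Suc CARD('n wo)"
      using X inj by (simp add: card_wo card_image inj_on_subset)
    have "bij_betw ?h (X - {x0}) (?h ` (X - {x0}))"
      using inj by (auto intro: inj_on_subset inj_on_imp_bij_betw)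
    moreover have "?h ` (X - {x0}) = ?h ` X - {?h x0}"
      using inj by (auto simp: inj_def)
    ultimately show "bij_betw (?h \<circ> f \<circ> unwo) UNIV (?h ` X - {?h x0})"
      using bij_betw_trans[OF bij_betw_trans[OF bij_unwo f]] by (simp add: comp_assoc)
  qed (use X in auto)
  also have "(\<chi> i j. (?h \<circ> f \<circ> unwo) j $ i - ?h x0 $ i) =
      (\<chi> i j. (\<chi> i j. f j $ i - x0 $ i) $ unwo i $ unwo j)"
    by (simp add: vec_eq_iff)
  also have "det \<dots> = det (\<chi> i j. f j $ i - x0 $ i)" by (rule det_reindex[OF bij_unwo])
  finally show ?thesis by (simp add: card_wo)
qed

section \<open>Adding a segment to a convex body\<close>

lemma compact_set_plus:
  fixes S T :: "'a::real_normed_vector set"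
  assumes "compact S" "compact T"
  shows "compact (S + T)"
  using compact_sums[OF assms] by (simp add: set_plus_def conj_comms Bex_def)

lemma compact_set_sum:
  fixes S :: "'i \<Rightarrow> 'a::real_normed_vector set"
  assumes "\<And>i. i \<in> A \<Longrightarrow> compact (S i)"
  shows "compact (\<Sum>i\<in>A. S i)"
  using assms
  by (induction A rule: infinite_finite_induct) (auto intro!: compact_set_plus simp: set_zero)

lemma linear_image_set_plus:
  assumes "linear f"
  shows "f ` (S + T) = f ` S + f ` T"
  unfolding set_plus_image image_image split_def
  by (force simp: linear_add[OF assms])

lemma linear_image_set_sum:
  assumes "linear f"
  shows "f ` (\<Sum>i\<in>A. S i) = (\<Sum>i\<in>A. f ` S i)"
  by (induction A rule: infinite_finite_induct)
    (simp_all add: set_zero linear_image_set_plus[OF assms] linear_0[OF assms])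

lemma translation_eq_plus: "(+) (x :: 'a::plus) ` S = {x} + S"
  by (auto simp: set_plus_def)

lemma closed_segment_translate_sum:
  fixes a b :: "'i \<Rightarrow> 'a::real_vector"
  assumes "finite A"
  shows "(\<Sum>i\<in>A. closed_segment (a i) (b i)) = (+) (\<Sum>i\<in>A. a i) ` (\<Sum>i\<in>A. closed_segment 0 (b i - a i))"
  using assms
proof (induction A)
  case empty then show ?case by (simp add: set_zero)
next
  case (insert i A)
  have seg: "closed_segment (a i) (b i) = (+) (a i) ` closed_segment 0 (b i - a i)"
    using closed_segment_translation[of "a i" 0 "b i - a i"] by simp
  have plus: "(+) x ` S + (+) y ` T = (+) (x + y) ` (S + T)" for x y :: 'a and S T
  proof -
    have "{x} + {y} = {x + y}" by (auto simp: set_plus_def)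
    then show ?thesis unfolding translation_eq_plus by (metis add.assoc add.commute)
  qed
  show ?case
    using insert by (simp add: seg plus)
qed

lemma mem_plus_segment:
  fixes K :: "'a::real_vector set"
  assumes "0 \<le> t"
  shows "x \<in> K + closed_segment 0 (t *\<^sub>R u) \<longleftrightarrow> (\<exists>r\<in>{0..t}. x - r *\<^sub>R u \<in> K)"
proof
  assume "x \<in> K + closed_segment 0 (t *\<^sub>R u)"
  then obtain k c where "x = k + c *\<^sub>R t *\<^sub>R u" "k \<in> K" "0 \<le> c" "c \<le> 1"
    by (auto simp: set_plus_def in_segment)
  then show "\<exists>r\<in>{0..t}. x - r *\<^sub>R u \<in> K"
    using assms by (intro bexI[of _ "c * t"]) (auto simp: mult_left_le_one_le)
next
  assume "\<exists>r\<in>{0..t}. x - r *\<^sub>R u \<in> K"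
  then obtain r where r: "0 \<le> r" "r \<le> t" "x - r *\<^sub>R u \<in> K" by auto
  \<comment> \<open>If \<open>t = 0\<close> then \<open>r = 0\<close> as well, so the equation
    survives the division by zero.\<close>
  have "r *\<^sub>R u = (r / t) *\<^sub>R t *\<^sub>R u" using r by auto
  then have "r *\<^sub>R u \<in> closed_segment 0 (t *\<^sub>R u)"
    using r assms by (auto simp: in_segment intro!: exI[of _ "r / t"] divide_le_eq_1[THEN iffD2])
  then have "(x - r *\<^sub>R u) + r *\<^sub>R u \<in> K + closed_segment 0 (t *\<^sub>R u)" using r by blast
  then show "x \<in> K + closed_segment 0 (t *\<^sub>R u)" by simp
qed

lemma subset_plus_segment: "K \<subseteq> K + closed_segment 0 (u :: 'a::real_vector)"
  using set_zero_plus2[of "closed_segment 0 u" K] by (simp add: add.commute)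

text \<open>Moving the segment of length \<open>s\<close> to its end shows that the part of \<open>K + [0, (s + t) u]\<close>
  outside \<open>K + [0, s u]\<close> is the translate by \<open>s u\<close> of the part of \<open>K + [0, t u]\<close> outside \<open>K\<close>.\<close>

lemma plus_segment_diff:
  fixes K :: "'a::real_vector set"
  assumes K: "convex K" and st: "0 \<le> s" "0 \<le> t"
  shows "(K + closed_segment 0 ((s + t) *\<^sub>R u)) - (K + closed_segment 0 (s *\<^sub>R u))
    = (+) (s *\<^sub>R u) ` ((K + closed_segment 0 (t *\<^sub>R u)) - K)"
proof (intro equalityI subsetI)
  fix x assume "x \<in> (K + closed_segment 0 ((s + t) *\<^sub>R u)) - (K + closed_segment 0 (s *\<^sub>R u))"
  then obtain r where r: "0 \<le> r" "r \<le> s + t" "x - r *\<^sub>R u \<in> K"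
    and not: "\<And>r. 0 \<le> r \<Longrightarrow> r \<le> s \<Longrightarrow> x - r *\<^sub>R u \<notin> K"
    using st by (auto simp: mem_plus_segment)
  have "x - s *\<^sub>R u - (r - s) *\<^sub>R u \<in> K" using r by (simp add: algebra_simps)
  moreover have "s < r" using r not[of r] by (rule_tac ccontr) auto
  ultimately have "x - s *\<^sub>R u \<in> (K + closed_segment 0 (t *\<^sub>R u)) - K"
    using r not[of s] st by (auto simp: mem_plus_segment intro!: bexI[of _ "r - s"])
  then show "x \<in> (+) (s *\<^sub>R u) ` ((K + closed_segment 0 (t *\<^sub>R u)) - K)"
    by (intro image_eqI[of _ _ "x - s *\<^sub>R u"]) auto
next
  fix x assume "x \<in> (+) (s *\<^sub>R u) ` ((K + closed_segment 0 (t *\<^sub>R u)) - K)"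
  then obtain y r where y: "x = s *\<^sub>R u + y" "y \<notin> K" and r: "0 \<le> r" "r \<le> t" "y - r *\<^sub>R u \<in> K"
    using st by (auto simp: mem_plus_segment)
  have "x \<notin> K + closed_segment 0 (s *\<^sub>R u)"
  proof
    assume "x \<in> K + closed_segment 0 (s *\<^sub>R u)"
    then obtain q where q: "0 \<le> q" "q \<le> s" "x - q *\<^sub>R u \<in> K"
      using st by (auto simp: mem_plus_segment)
    \<comment> \<open>Now \<open>K\<close> contains \<open>y + p *\<^sub>R u\<close> and
      \<open>y - r *\<^sub>R u\<close>. The point \<open>y\<close> lies between them, so convexity
      puts it into \<open>K\<close>, a contradiction; only \<open>p + r = 0\<close> must be treated
      apart, as the weights divide by it.\<close>
    define p where "p = s - q"
    have p: "0 \<le> p" "y + p *\<^sub>R u \<in> K" using q y by (auto simp: p_def algebra_simps)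
    show False
    proof (cases "p + r = 0")
      case True
      then have "p = 0" using p r by linarith
      then show False using p y by simp
    next
      case False
      then have pos: "p + r > 0" using p r by auto
      have "(p / (p + r)) *\<^sub>R (y - r *\<^sub>R u) + (r / (p + r)) *\<^sub>R (y + p *\<^sub>R u) \<in> K"
        using p r pos by (intro convexD[OF K]) (auto simp flip: add_divide_distrib)
      moreover have "(p / (p + r)) *\<^sub>R (y - r *\<^sub>R u) + (r / (p + r)) *\<^sub>R (y + p *\<^sub>R u)
          = (p / (p + r) + r / (p + r)) *\<^sub>R y"
        by (simp add: algebra_simps)
      moreover have "p / (p + r) + r / (p + r) = 1" using pos by (simp flip: add_divide_distrib)
      ultimately show False using y by simp
    qed
  qed
  moreover have "x - (s + r) *\<^sub>R u \<in> K" using r y by (simp add: algebra_simps)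
  then have "x \<in> K + closed_segment 0 ((s + t) *\<^sub>R u)"
    using r st by (auto simp: mem_plus_segment intro!: bexI[of _ "s + r"])
  ultimately show "x \<in> (K + closed_segment 0 ((s + t) *\<^sub>R u)) - (K + closed_segment 0 (s *\<^sub>R u))" by blast
qed

text \<open>The volume gained between lengths s and s + t is that of a translate of the part gained
  between 0 and t. Hence the gain over \<open>K\<close> is an additive function of the
  length.\<close>

lemma measure_plus_segment_add:
  fixes K :: "'a::euclidean_space set" and u :: 'a
  assumes K: "convex K" "compact K" and st: "0 \<le> s" "0 \<le> t"
  defines "V \<equiv> \<lambda>t. measure lebesgue (K + closed_segment 0 (t *\<^sub>R u))"
  shows "V (s + t) - V s = V t - measure lebesgue K"
proof -
  have meas: "K + closed_segment 0 w \<in> lmeasurable" "K \<in> lmeasurable" for w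
    using K by (auto intro!: lmeasurable_compact compact_set_plus)
  have mono: "K + closed_segment 0 (s *\<^sub>R u) \<subseteq> K + closed_segment 0 ((s + t) *\<^sub>R u)"
    using st by (auto simp: subset_iff mem_plus_segment intro: order_trans)
  have "V (s + t) - V s
      = measure lebesgue ((K + closed_segment 0 ((s + t) *\<^sub>R u)) - (K + closed_segment 0 (s *\<^sub>R u)))"
    unfolding V_def by (rule measurable_measure_Diff[symmetric]) (use meas mono in auto)
  also have "\<dots> = measure lebesgue ((K + closed_segment 0 (t *\<^sub>R u)) - K)"
    by (simp only: plus_segment_diff[OF K(1) st] measure_translation)
  also have "\<dots> = V t - measure lebesgue K"
    unfolding V_def by (rule measurable_measure_Diff) (use meas subset_plus_segment in auto)
  finally show ?thesis .
qed

text \<open>Cauchy's functional equation on the half-line. Nonnegativity makes \<open>g\<close>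
  monotone; squeezing n t between consecutive integers k and k + 1 bounds n times the error by
  \<open>g 1\<close> for every n, so the error is 0.\<close>

lemma additive_nonneg_imp_linear:
  fixes g :: "real \<Rightarrow> real"
  assumes add: "\<And>s t. 0 \<le> s \<Longrightarrow> 0 \<le> t \<Longrightarrow> g (s + t) = g s + g t"
    and nonneg: "\<And>t. 0 \<le> t \<Longrightarrow> 0 \<le> g t" and t: "0 \<le> t"
  shows "g t = t * g 1"
proof -
  have mult: "g (real n * s) = real n * g s" if "0 \<le> s" for n s
  proof (induction n)
    case 0 show ?case using add[of 0 0] by simp
  next
    case (Suc n) then show ?case using add[of s "real n * s"] that by (simp add: algebra_simps)
  qed
  have mono: "g a \<le> g b" if "0 \<le> a" "a \<le> b" for a b
    using add[of a "b - a"] nonneg[of "b - a"] that by simp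
  have "real n * \<bar>g t - t * g 1\<bar> \<le> g 1" for n
  proof -
    define k where "k = nat \<lfloor>real n * t\<rfloor>"
    have k: "real k \<le> real n * t" "real n * t \<le> real (Suc k)"
      using t by (auto simp: k_def of_nat_nat) linarith+
    have "real k * g 1 \<le> real n * g t" "real n * g t \<le> real (Suc k) * g 1"
      using mono[of "real k" "real n * t"] mono[of "real n * t" "real (Suc k)"] k t
        mult[of 1 k] mult[of 1 "Suc k"] mult[of t n] by auto
    moreover have "real k * g 1 \<le> real n * t * g 1" "real n * t * g 1 \<le> real (Suc k) * g 1"
      using k nonneg[of 1] by (auto intro: mult_right_mono)
    ultimately have "\<bar>real n * g t - real n * t * g 1\<bar> \<le> g 1" by (auto simp: algebra_simps)
    moreover have "real n * \<bar>g t - t * g 1\<bar> = \<bar>real n * (g t - t * g 1)\<bar>"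
      by (simp add: abs_mult)
    ultimately show ?thesis by (simp add: right_diff_distrib mult.assoc)
  qed
  then have "\<not> 0 < \<bar>g t - t * g 1\<bar>"
    using ex_less_of_nat_mult[of "\<bar>g t - t * g 1\<bar>" "g 1"] by (meson not_less)
  then show ?thesis by simp
qed

lemma measure_plus_segment_affine:
  fixes K :: "'a::euclidean_space set" and u :: 'a
  assumes K: "convex K" "compact K" and t: "0 \<le> t"
  defines "V \<equiv> \<lambda>t. measure lebesgue (K + closed_segment 0 (t *\<^sub>R u))"
  shows "V t = measure lebesgue K + t * (V 1 - measure lebesgue K)"
proof -
  have "V t - measure lebesgue K = t * (V 1 - measure lebesgue K)"
  proof (rule additive_nonneg_imp_linear[OF _ _ t])
    show "V (r + s) - measure lebesgue K = (V r - measure lebesgue K) + (V s - measure lebesgue K)"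
      if "0 \<le> r" "0 \<le> s" for r s
      using measure_plus_segment_add[OF K that, of u] by (simp add: V_def)
    show "0 \<le> V r - measure lebesgue K" for r
      unfolding V_def using K subset_plus_segment
      by (auto intro!: measure_mono_fmeasurable compact_set_plus lmeasurable_compact fmeasurableD)
  qed
  then show ?thesis by simp
qed

section \<open>Volumes of projections of zonotopes\<close>

text \<open>Induction on \<open>M\<close>: \<open>f\<close> is interpolated between its slices at
  \<open>\<mu> k = 0\<close> and \<open>\<mu> k = 1\<close>, each multi-affine in the remaining
  variables. All arguments are kept nonnegative because they will be segment lengths, for which
  affinity holds only on the half-line.\<close>

lemma multiaffine_expansion:
  fixes f :: "('i \<Rightarrow> real) \<Rightarrow> real"
  assumes M: "finite M"
    and aff: "\<And>i \<mu>. i \<in> M \<Longrightarrow> (\<forall>j. 0 \<le> \<mu> j) \<Longrightarrow>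
      f \<mu> = f (\<mu>(i := 0)) + \<mu> i * (f (\<mu>(i := 1)) - f (\<mu>(i := 0)))"
  obtains c where "\<And>\<mu>. (\<forall>j. 0 \<le> \<mu> j) \<Longrightarrow> (\<forall>j. j \<notin> M \<longrightarrow> \<mu> j = 0) \<Longrightarrow>
      f \<mu> = (\<Sum>S\<in>Pow M. c S * (\<Prod>i\<in>S. \<mu> i))"
proof -
  have "\<exists>c. \<forall>\<mu>. (\<forall>j. 0 \<le> \<mu> j) \<longrightarrow> (\<forall>j. j \<notin> M \<longrightarrow> \<mu> j = 0) \<longrightarrow>
      f \<mu> = (\<Sum>S\<in>Pow M. c S * (\<Prod>i\<in>S. \<mu> i))"
    using M aff
  proof (induction M arbitrary: f)
    case empty
    show ?case
    proof (intro exI[of _ "\<lambda>_. f (\<lambda>_. 0)"] allI impI)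
      fix \<mu> :: "'i \<Rightarrow> real" assume "\<forall>j. j \<notin> {} \<longrightarrow> \<mu> j = 0"
      then have "\<mu> = (\<lambda>_. 0)" by auto
      then show "f \<mu> = (\<Sum>S\<in>Pow {}. f (\<lambda>_. 0) * (\<Prod>i\<in>S. \<mu> i))" by simp
    qed
  next
    case (insert k M)
    obtain c0 where c0: "\<And>\<mu>. (\<forall>j. 0 \<le> \<mu> j) \<Longrightarrow> (\<forall>j. j \<notin> M \<longrightarrow> \<mu> j = 0) \<Longrightarrow>
        f \<mu> = (\<Sum>S\<in>Pow M. c0 S * (\<Prod>i\<in>S. \<mu> i))"
      using insert.IH[of f] insert.prems by auto
    have "\<exists>c. \<forall>\<mu>. (\<forall>j. 0 \<le> \<mu> j) \<longrightarrow> (\<forall>j. j \<notin> M \<longrightarrow> \<mu> j = 0) \<longrightarrow>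
        f (\<mu>(k := 1)) = (\<Sum>S\<in>Pow M. c S * (\<Prod>i\<in>S. \<mu> i))"
    proof (rule insert.IH)
      fix i and \<mu> :: "'i \<Rightarrow> real" assume i: "i \<in> M" and \<mu>: "\<forall>j. 0 \<le> \<mu> j"
      have "i \<noteq> k" using i insert.hyps by auto
      then show "f (\<mu>(k := 1)) = f (\<mu>(i := 0, k := 1))
          + \<mu> i * (f (\<mu>(i := 1, k := 1)) - f (\<mu>(i := 0, k := 1)))"
        using insert.prems[of i "\<mu>(k := 1)"] i \<mu>
        by (simp add: fun_upd_twist[of i k] del: fun_upd_apply) (simp add: fun_upd_apply)
    qed
    then obtain c1 where c1: "\<And>\<mu>. (\<forall>j. 0 \<le> \<mu> j) \<Longrightarrow> (\<forall>j. j \<notin> M \<longrightarrow> \<mu> j = 0) \<Longrightarrow>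
        f (\<mu>(k := 1)) = (\<Sum>S\<in>Pow M. c1 S * (\<Prod>i\<in>S. \<mu> i))" by blast
    \<comment> \<open>Monomials without \<open>k\<close> come from the slice at 0, those with
      \<open>k\<close> from the difference of the two slices.\<close>
    define c where "c S = (if k \<in> S then c1 (S - {k}) - c0 (S - {k}) else c0 S)" for S
    show ?case
    proof (intro exI[of _ c] allI impI)
      fix \<mu> :: "'i \<Rightarrow> real" assume \<mu>: "\<forall>j. 0 \<le> \<mu> j" "\<forall>j. j \<notin> insert k M \<longrightarrow> \<mu> j = 0"
      have prod: "(\<Prod>i\<in>S. (\<mu>(k := 0)) i) = (\<Prod>i\<in>S. \<mu> i)" if "S \<in> Pow M" for S
        using that insert.hyps by (intro prod.cong) auto
      have "f \<mu> = f (\<mu>(k := 0)) + \<mu> k * (f ((\<mu>(k := 0))(k := 1)) - f (\<mu>(k := 0)))"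
        using insert.prems[OF insertI1 \<mu>(1)] by (simp only: fun_upd_upd)
      also have "f (\<mu>(k := 0)) = (\<Sum>S\<in>Pow M. c0 S * (\<Prod>i\<in>S. (\<mu>(k := 0)) i))"
        using \<mu> by (intro c0) auto
      also have "\<dots> = (\<Sum>S\<in>Pow M. c S * (\<Prod>i\<in>S. \<mu> i))"
        using insert.hyps by (intro sum.cong refl) (subst prod, auto simp: c_def)
      also have "f ((\<mu>(k := 0))(k := 1)) = (\<Sum>S\<in>Pow M. c1 S * (\<Prod>i\<in>S. (\<mu>(k := 0)) i))"
        using \<mu> by (intro c1) auto
      also have "\<mu> k * (\<dots> - (\<Sum>S\<in>Pow M. c S * (\<Prod>i\<in>S. \<mu> i)))
          = (\<Sum>S\<in>Pow M. c (insert k S) * (\<Prod>i\<in>insert k S. \<mu> i))"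
        unfolding sum_subtractf[symmetric] sum_distrib_left
      proof (intro sum.cong refl)
        fix S assume S: "S \<in> Pow M"
        then have "k \<notin> S" "finite S" using insert.hyps finite_subset by auto
        then show "\<mu> k * (c1 S * (\<Prod>i\<in>S. (\<mu>(k := 0)) i) - c S * (\<Prod>i\<in>S. \<mu> i))
            = c (insert k S) * (\<Prod>i\<in>insert k S. \<mu> i)"
          by (simp only: prod[OF S]) (simp add: c_def algebra_simps)
      qed
      also have "\<dots> = (\<Sum>S\<in>insert k ` Pow M. c S * (\<Prod>i\<in>S. \<mu> i))"
        using insert.hyps by (intro sum.reindex_cong[symmetric, of "insert k"]) (auto simp: inj_on_def)
      also have "(\<Sum>S\<in>Pow M. c S * (\<Prod>i\<in>S. \<mu> i)) + \<dots> = (\<Sum>S\<in>Pow (insert k M). c S * (\<Prod>i\<in>S. \<mu> i))"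
        unfolding Pow_insert using insert.hyps by (intro sum.union_disjoint[symmetric]) auto
      finally show "f \<mu> = (\<Sum>S\<in>Pow (insert k M). c S * (\<Prod>i\<in>S. \<mu> i))" .
    qed
  qed
  then show thesis using that by blast
qed

text \<open>Homogeneity leaves only the monomials of degree \<open>k\<close>. At the indicator of a
  \<open>k\<close>-element set T just the monomial of T survives, since a \<open>k\<close>-element
  subset of T is T itself; so the values at these indicators are the coefficients.\<close>

lemma multiaffine_homogeneous:
  fixes f :: "('i \<Rightarrow> real) \<Rightarrow> real"
  assumes M: "finite M"
    and aff: "\<And>i \<mu>. i \<in> M \<Longrightarrow> (\<forall>j. 0 \<le> \<mu> j) \<Longrightarrow>
      f \<mu> = f (\<mu>(i := 0)) + \<mu> i * (f (\<mu>(i := 1)) - f (\<mu>(i := 0)))"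
    and hom: "\<And>t \<mu>. 0 < t \<Longrightarrow> (\<forall>j. 0 \<le> \<mu> j) \<Longrightarrow> f (\<lambda>j. t * \<mu> j) = t ^ k * f \<mu>"
  shows "f (indicator M) = (\<Sum>S | S \<subseteq> M \<and> card S = k. f (indicator S))"
proof -
  obtain c where c: "\<And>\<mu>. (\<forall>j. 0 \<le> \<mu> j) \<Longrightarrow> (\<forall>j. j \<notin> M \<longrightarrow> \<mu> j = 0) \<Longrightarrow>
      f \<mu> = (\<Sum>S\<in>Pow M. c S * (\<Prod>i\<in>S. \<mu> i))"
    using multiaffine_expansion[OF M, of f] aff by blast
  have c': "f \<mu> = (\<Sum>S | S \<subseteq> M \<and> card S = k. c S * (\<Prod>i\<in>S. \<mu> i))"
    if \<mu>: "\<forall>j. 0 \<le> \<mu> j" "\<forall>j. j \<notin> M \<longrightarrow> \<mu> j = 0" for \<mu>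
  proof -
    \<comment> \<open>The restriction of the expansion to the ray through \<open>\<mu>\<close>,
      minus its value by homogeneity. It vanishes at every positive t, hence is the zero polynomial,
      and its coefficient of degree \<open>k\<close> gives the claim.\<close>
    define p where "p = (\<Sum>S\<in>Pow M. monom (c S * (\<Prod>i\<in>S. \<mu> i)) (card S)) - monom (f \<mu>) k"
    have "poly p t = 0" if "0 < t" for t
    proof -
      have "(\<Sum>S\<in>Pow M. c S * (\<Prod>i\<in>S. \<mu> i) * t ^ card S) = (\<Sum>S\<in>Pow M. c S * (\<Prod>i\<in>S. t * \<mu> i))"
        by (intro sum.cong refl) (simp add: prod.distrib)
      also have "\<dots> = f (\<lambda>j. t * \<mu> j)" using \<mu> that by (intro c[symmetric]) auto
      also have "\<dots> = t ^ k * f \<mu>" using \<mu> that by (intro hom) auto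
      finally show ?thesis by (simp add: p_def poly_sum poly_monom)
    qed
    then have "{0<..} \<subseteq> {t. poly p t = 0}" by auto
    then have "p = 0"
      using poly_roots_finite[of p] infinite_Ioi[of "0::real"] finite_subset by blast
    then have "coeff p k = 0" by simp
    then have "f \<mu> = (\<Sum>S\<in>Pow M. if card S = k then c S * (\<Prod>i\<in>S. \<mu> i) else 0)"
      by (simp add: p_def coeff_sum)
    also have "\<dots> = (\<Sum>S | S \<subseteq> M \<and> card S = k. c S * (\<Prod>i\<in>S. \<mu> i))"
      using M by (intro sum.mono_neutral_cong_right) auto
    finally show ?thesis .
  qed
  have ind: "f (indicator T) = c T" if T: "T \<subseteq> M" "card T = k" for T
  proof -
    have "f (indicator T) = (\<Sum>S | S \<subseteq> M \<and> card S = k. c S * (\<Prod>i\<in>S. indicator T i))"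
      using T by (intro c') (auto simp: indicator_def)
    also have "\<dots> = (\<Sum>S | S \<subseteq> M \<and> card S = k. if S = T then c S else 0)"
    proof (intro sum.cong refl)
      fix S assume S: "S \<in> {S. S \<subseteq> M \<and> card S = k}"
      have fin: "finite S" "finite T" using S T M finite_subset by auto
      show "c S * (\<Prod>i\<in>S. indicator T i) = (if S = T then c S else 0)"
      proof (cases "S \<subseteq> T")
        case True
        then have "S = T" using S T fin by (intro card_subset_eq) auto
        then show ?thesis by simp
      next
        case False
        then show ?thesis using fin by (auto simp: indicator_def)
      qed
    qed
    also have "\<dots> = c T" using T M by simp
    finally show ?thesis .
  qed
  have "f (indicator M) = (\<Sum>S | S \<subseteq> M \<and> card S = k. c S * (\<Prod>i\<in>S. indicator M i))"
    by (intro c') auto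
  also have "\<dots> = (\<Sum>S | S \<subseteq> M \<and> card S = k. f (indicator S))"
    by (intro sum.cong refl) (auto simp: ind subset_iff)
  finally show ?thesis .
qed

text \<open>The volume of the projection of \<open>K\<close> to the axes in \<open>I\<close>, written as a full-dimensional
  volume by adding the unit cube in the remaining coordinates.\<close>

definition cvol :: "'n set \<Rightarrow> (real ^ 'n::finite) set \<Rightarrow> real" where
  "cvol I K = measure lebesgue (coord_proj I ` K + cbox 0 (\<chi> i. if i \<in> I then 0 else 1))"

text \<open>The normal form of a zonotope up to translation. The index type is arbitrary so that
  cube vertices can index their own generators.\<close>

definition zono :: "'i set \<Rightarrow> ('i \<Rightarrow> 'a::real_vector) \<Rightarrow> 'a set" where
  "zono M u = (\<Sum>i\<in>M. closed_segment 0 (u i))"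

lemma compact_zono: "compact (zono M (u :: 'i \<Rightarrow> 'a::real_normed_vector))"
  unfolding zono_def by (rule compact_set_sum) auto

lemma convex_zono: "convex (zono M u)"
  unfolding zono_def by (rule convex_set_sum) auto

lemma linear_coord_proj: "linear (coord_proj I)"
  by (rule linearI) (auto simp: coord_proj_def vec_eq_iff)

lemma continuous_on_coord_proj: "continuous_on S (coord_proj I)"
  using linear_coord_proj by (rule linear_continuous_on[OF linear_conv_bounded_linear[THEN iffD1]])

lemma linear_image_zono: "linear f \<Longrightarrow> f ` zono M u = zono M (\<lambda>i. f (u i))"
  unfolding zono_def
  by (simp add: linear_image_set_sum closed_segment_linear_image[symmetric] linear_0)

lemma cvol_UNIV: "cvol UNIV (K :: (real^'n::finite) set) = measure lebesgue K"
proof -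
  have "cbox 0 (\<chi> i. if i \<in> UNIV then 0 else 1) = {0 :: real^'n}"
    by (simp add: zero_vec_def[symmetric])
  moreover have "coord_proj UNIV ` K = K" by (auto simp: coord_proj_def)
  ultimately show ?thesis by (simp only: cvol_def set_add_0_right)
qed

lemma cvol_translation: "cvol I ((+) a ` K) = cvol I K"
proof -
  have "coord_proj I ` (+) a ` K + B = (+) (coord_proj I a) ` (coord_proj I ` K + B)" for B
    by (simp add: translation_eq_plus linear_image_set_plus[OF linear_coord_proj] add.assoc)
  then show ?thesis unfolding cvol_def by (simp add: measure_translation)
qed

lemma compact_cvol_body: "compact K \<Longrightarrow> compact (coord_proj I ` K + cbox 0 b)"
  by (intro compact_set_plus compact_continuous_image continuous_on_coord_proj) auto

lemma convex_cvol_body: "convex K \<Longrightarrow> convex (coord_proj I ` K + cbox 0 b)"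
  by (intro convex_set_plus convex_linear_image linear_coord_proj) auto

text \<open>Adding a segment to \<open>K\<close> adds the projected segment to the fattened
  projection, which is a convex body of full dimension; the affine formula for such bodies applies
  to it.\<close>

lemma cvol_plus_segment_affine:
  assumes K: "convex K" "compact K" and t: "0 \<le> t"
  shows "cvol I (K + closed_segment 0 (t *\<^sub>R u))
    = cvol I K + t * (cvol I (K + closed_segment 0 u) - cvol I K)"
proof -
  let ?B = "coord_proj I ` K + cbox 0 (\<chi> i. if i \<in> I then 0 else 1)"
  have "cvol I (K + closed_segment 0 (s *\<^sub>R u))
      = measure lebesgue (?B + closed_segment 0 (s *\<^sub>R coord_proj I u))" for s
    by (simp add: cvol_def linear_image_set_plus linear_coord_proj ac_simps
      closed_segment_linear_image[symmetric] linear_0 linear_cmul)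
  note this[of t] this[of 1]
  then show ?thesis
    using measure_plus_segment_affine[OF convex_cvol_body[OF K(1)] compact_cvol_body[OF K(2)] t]
    by (simp add: cvol_def)
qed

text \<open>Scaling every axis would stretch the added cube too. The map \<open>?f\<close> scales
  only the axes in \<open>I\<close>: it fixes the cube, acts on the projection as ordinary scaling,
  and has determinant \<open>t ^ card I\<close>.\<close>

lemma cvol_scale:
  fixes K :: "(real^'n::finite) set"
  assumes K: "compact K" and t: "0 < t"
  shows "cvol I ((*\<^sub>R) t ` K) = t ^ card I * cvol I K"
proof -
  let ?b = "(\<chi> i. if i \<in> I then 0 else 1) :: real^'n"
  let ?f = "\<lambda>x::real^'n. \<chi> i. (if i \<in> I then t else 1) * x $ i"
  have lin: "linear ?f" by (rule linearI) (auto simp: vec_eq_iff algebra_simps)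
  have "?f (coord_proj I x) = coord_proj I (t *\<^sub>R x)" for x
    by (auto simp: coord_proj_def vec_eq_iff)
  moreover have "?f ` cbox 0 ?b = cbox 0 ?b"
  proof -
    have "?f x = x" if "x \<in> cbox 0 ?b" for x
      using that by (auto simp: mem_box_cart vec_eq_iff dest!: spec split: if_splits)
    then show ?thesis by force
  qed
  ultimately have "?f ` (coord_proj I ` K + cbox 0 ?b) = coord_proj I ` (*\<^sub>R) t ` K + cbox 0 ?b"
    by (simp add: linear_image_set_plus[OF lin] image_image)
  then have "cvol I ((*\<^sub>R) t ` K) = measure lebesgue (?f ` (coord_proj I ` K + cbox 0 ?b))"
    by (simp add: cvol_def)
  also have "\<dots> = \<bar>det (matrix ?f)\<bar> * cvol I K"
    unfolding cvol_def by (rule measure_linear_image_finite[OF lin compact_cvol_body[OF K]])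
  also have "det (matrix ?f) = (\<Prod>i\<in>UNIV. if i \<in> I then t else 1)"
    by (subst det_diagonal) (auto simp: matrix_def axis_def)
  also have "\<dots> = t ^ card I"
    by (simp add: prod.If_cases)
  finally show ?thesis using t by simp
qed

lemma zono_insert:
  assumes "finite M" "i \<in> M"
  shows "zono M u = zono (M - {i}) u + closed_segment 0 (u i)"
  using assms by (simp add: zono_def sum.remove[of M i] add.commute)

lemma zono_cong: "(\<And>i. i \<in> M \<Longrightarrow> u i = v i) \<Longrightarrow> zono M u = zono M v"
  by (simp add: zono_def)

text \<open>In the segment lengths the projected volume is multi-affine and homogeneous of degree
  \<open>card I\<close>; a 0/1 vector of lengths switches generators on and off, so values at
  indicators are volumes of smaller zonotopes.\<close>

lemma cvol_zono:
  fixes u :: "'i \<Rightarrow> real^'n::finite"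
  assumes M: "finite M"
  shows "cvol I (zono M u) = (\<Sum>S | S \<subseteq> M \<and> card S = card I. cvol I (zono S u))"
proof -
  define f where "f \<mu> = cvol I (zono M (\<lambda>i. \<mu> i *\<^sub>R u i))" for \<mu>
  have ind: "f (indicator S) = cvol I (zono S u)" if "S \<subseteq> M" for S
  proof -
    have "zono M (\<lambda>i. indicator S i *\<^sub>R u i) = zono S u"
      unfolding zono_def using that M
      by (intro sum.mono_neutral_cong_right) (auto simp: set_zero indicator_def)
    then show ?thesis by (simp add: f_def)
  qed
  have "f (indicator M) = (\<Sum>S | S \<subseteq> M \<and> card S = card I. f (indicator S))"
  proof (rule multiaffine_homogeneous[OF M])
    fix i and \<mu> :: "'i \<Rightarrow> real" assume i: "i \<in> M" and \<mu>: "\<forall>j. 0 \<le> \<mu> j"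
    let ?Z = "zono (M - {i}) (\<lambda>i. \<mu> i *\<^sub>R u i)"
    have eq: "f (\<mu>(i := t)) = cvol I (?Z + closed_segment 0 (t *\<^sub>R u i))" for t
    proof -
      have "zono (M - {i}) (\<lambda>j. (\<mu>(i := t)) j *\<^sub>R u j) = ?Z" by (rule zono_cong) auto
      then show ?thesis by (simp add: f_def zono_insert[OF M i])
    qed
    show "f \<mu> = f (\<mu>(i := 0)) + \<mu> i * (f (\<mu>(i := 1)) - f (\<mu>(i := 0)))"
      using eq[of "\<mu> i"] cvol_plus_segment_affine[OF convex_zono compact_zono, of "\<mu> i" I "M - {i}" "\<lambda>i. \<mu> i *\<^sub>R u i" "u i"] \<mu>
      by (simp add: eq)
  next
    fix t :: real and \<mu> :: "'i \<Rightarrow> real" assume t: "0 < t"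
    have "zono M (\<lambda>i. (t * \<mu> i) *\<^sub>R u i) = (*\<^sub>R) t ` zono M (\<lambda>i. \<mu> i *\<^sub>R u i)"
      by (simp add: linear_image_zono linear_scaleR)
    then show "f (\<lambda>j. t * \<mu> j) = t ^ card I * f \<mu>"
      by (simp add: f_def cvol_scale[OF compact_zono t])
  qed
  then show ?thesis
    using ind[OF subset_refl] by (simp add: ind)
qed

text \<open>Once the cube is itself a sum of segments, its linear images are sums of the images of
  the segments. The form with \<open>J\<close> also covers the cube used for fattening.\<close>

lemma cbox_eq_sum_segments:
  "cbox 0 (\<chi> i. if i \<in> J then 1 else 0) = zono J (\<lambda>i. axis i 1 :: real^'n::finite)"
proof -
  have "zono J (\<lambda>i. axis i 1 :: real^'n) = (\<lambda>t. \<chi> i. if i \<in> J then t i else 0) ` (UNIV \<rightarrow> {0..1})"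
  proof -
    have sum: "(\<Sum>i\<in>J. s i *\<^sub>R axis i 1) = (\<chi> i. if i \<in> J then s i else 0 :: real^'n)" for s
      by (auto simp: vec_eq_iff axis_def if_distrib cong: if_cong)
    have "zono J (\<lambda>i. axis i 1 :: real^'n) = {\<Sum>i\<in>J. s i |s. \<forall>i\<in>J. \<exists>t\<in>{0..1}. s i = t *\<^sub>R axis i 1}"
      by (simp add: zono_def set_sum_alt in_segment Bex_def conj_ac)
    also have "\<dots> = {\<Sum>i\<in>J. t i *\<^sub>R axis i 1 |t. t \<in> UNIV \<rightarrow> {0..1}}" (is "?L = ?R")
    proof (intro equalityI subsetI)
      fix x assume "x \<in> ?L"
      then obtain s where s: "x = sum s J" and "\<forall>i\<in>J. \<exists>t\<in>{0..1}. s i = t *\<^sub>R axis i 1" by blast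
      then obtain t where t: "\<forall>i\<in>J. t i \<in> {0..1} \<and> s i = t i *\<^sub>R axis i 1" by metis
      then show "x \<in> ?R"
        by (auto simp: s intro!: exI[of _ "\<lambda>i. if i \<in> J then t i else 0"] sum.cong)
    next
      fix x assume "x \<in> ?R" then show "x \<in> ?L" by (fastforce simp: Pi_iff)
    qed
    finally show ?thesis by (auto simp: sum)
  qed
  moreover have "(\<lambda>t. \<chi> i. if i \<in> J then t i else 0) ` (UNIV \<rightarrow> {0..1})
      = cbox 0 (\<chi> i. if i \<in> J then 1 else 0 :: real^'n)"
  proof (intro equalityI subsetI)
    fix x assume "x \<in> cbox 0 (\<chi> i. if i \<in> J then 1 else 0 :: real^'n)"
    then have x: "0 \<le> x $ i" "x $ i \<le> (if i \<in> J then 1 else 0)" for i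
      by (auto simp: mem_box_cart)
    have "0 \<le> x $ i \<and> x $ i \<le> 1" "i \<notin> J \<Longrightarrow> x $ i = 0" for i
      using x[of i] by (auto split: if_splits)
    then show "x \<in> (\<lambda>t. \<chi> i. if i \<in> J then t i else 0) ` (UNIV \<rightarrow> {0..1})"
      by (intro image_eqI[of _ _ "\<lambda>i. x $ i"]) (auto simp: vec_eq_iff)
  qed (auto simp: mem_box_cart Pi_iff)
  ultimately show ?thesis by simp
qed

text \<open>The matrix has the projected generators as columns in \<open>I\<close> and unit vectors
  elsewhere, so it maps the unit cube onto the fattened projection.\<close>

lemma cvol_parallelepiped:
  fixes u :: "'i \<Rightarrow> real^'n::finite"
  assumes \<sigma>: "bij_betw \<sigma> I S"
  shows "cvol I (zono S u)
    = \<bar>det (\<chi> r c. if c \<in> I then coord_proj I (u (\<sigma> c)) $ r else axis c 1 $ r)\<bar>"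
proof -
  let ?A = "(\<chi> r c. if c \<in> I then coord_proj I (u (\<sigma> c)) $ r else axis c 1 $ r) :: real^'n^'n"
  have lin: "linear ((*v) ?A)" by (rule matrix_vector_mul_linear)
  have box: "cbox 0 (\<chi> i. if i \<in> I then 0 else 1) = zono (- I) (\<lambda>c. axis c 1 :: real^'n)"
    by (subst cbox_eq_sum_segments[symmetric]) (auto intro!: arg_cong[of _ _ "cbox 0"] simp: vec_eq_iff)
  have unit: "cbox 0 1 = zono UNIV (\<lambda>c. axis c 1 :: real^'n)"
    by (subst cbox_eq_sum_segments[symmetric]) (auto intro!: arg_cong[of _ _ "cbox 0"] simp: vec_eq_iff)
  have "(*v) ?A ` cbox 0 1 = zono UNIV (\<lambda>c. column c ?A)"
    by (simp only: unit linear_image_zono[OF lin] matrix_vector_mult_basis)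
  also have "\<dots> = zono I (\<lambda>c. column c ?A) + zono (- I) (\<lambda>c. column c ?A)"
    unfolding zono_def by (subst sum.union_disjoint[symmetric]) auto
  also have "zono (- I) (\<lambda>c. column c ?A) = zono (- I) (\<lambda>c. axis c 1)"
    by (intro zono_cong) (auto simp: column_def vec_eq_iff)
  also have "zono I (\<lambda>c. column c ?A) = zono I (\<lambda>c. coord_proj I (u (\<sigma> c)))"
    by (intro zono_cong) (auto simp: column_def vec_eq_iff)
  also have "\<dots> = zono S (\<lambda>i. coord_proj I (u i))"
    unfolding zono_def by (rule sum.reindex_bij_betw[OF \<sigma>])
  also have "\<dots> = coord_proj I ` zono S u" by (rule linear_image_zono[OF linear_coord_proj, symmetric])
  finally have "cvol I (zono S u) = measure lebesgue ((*v) ?A ` cbox 0 1)"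
    by (simp add: cvol_def box)
  also have "\<dots> = \<bar>det ?A\<bar> * measure lebesgue (cbox 0 1 :: (real^'n) set)"
    by (subst measure_linear_image_finite[OF lin]) auto
  also have "measure lebesgue (cbox 0 1 :: (real^'n) set) = 1"
    by (subst measure_completion) (simp_all add: content_cbox_if_cart interval_ne_empty_cart)
  finally show ?thesis by simp
qed

section \<open>Projected volumes as product measures\<close>

lemma measurable_vec_lambda_PiM:
  "(\<lambda>f. \<chi> i. if i \<in> I then f i else 0) \<in> borel_measurable (Pi\<^sub>M I (\<lambda>_. lborel) :: ('n::finite \<Rightarrow> real) measure)"
  unfolding borel_measurable_euclidean_space[where 'c="real^'n"]
proof
  fix b :: "real^'n" assume "b \<in> Basis"
  then obtain i where b: "b = axis i 1" by (auto simp: Basis_vec_def)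
  show "(\<lambda>f. (\<chi> i. if i \<in> I then f i else 0) \<bullet> b) \<in> borel_measurable (Pi\<^sub>M I (\<lambda>_. lborel))"
    by (cases "i \<in> I") (auto simp: b inner_axis measurable_lborel2 intro!: measurable_component_singleton[THEN measurable_compose])
qed

lemma lborel_vec_PiM:
  "distr (Pi\<^sub>M UNIV (\<lambda>_. lborel)) borel (\<lambda>f. (\<chi> i. f i) :: real^'n::finite) = lborel"
proof (rule lborel_eqI[symmetric])
  interpret product_sigma_finite "\<lambda>_::'n. lborel :: real measure" ..
  let ?h = "\<lambda>f. (\<chi> i. f i) :: real^'n"
  fix l u :: "real^'n" assume le: "\<And>c. c \<in> Basis \<Longrightarrow> l \<bullet> c \<le> u \<bullet> c"
  have le': "l $ i \<le> u $ i" for i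
    using le[of "axis i 1"] by (simp add: inner_axis axis_in_Basis_iff)
  have meas: "?h \<in> borel_measurable (Pi\<^sub>M UNIV (\<lambda>_. lborel))"
    using measurable_vec_lambda_PiM[of UNIV] by simp
  have vimage: "?h -` box l u \<inter> space (Pi\<^sub>M UNIV (\<lambda>_. lborel)) = Pi\<^sub>E UNIV (\<lambda>i. box (l $ i) (u $ i))"
    by (auto simp: mem_box_cart space_PiM PiE_def Pi_iff)
  have "emeasure (distr (Pi\<^sub>M UNIV (\<lambda>_. lborel)) borel ?h) (box l u) = (\<Prod>i\<in>UNIV. emeasure lborel (box (l $ i) (u $ i)))"
    using meas by (simp add: emeasure_distr vimage emeasure_PiM)
  also have "\<dots> = (\<Prod>i\<in>UNIV. ennreal (u $ i - l $ i))"
    using le' by (intro prod.cong) auto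
  also have "\<dots> = (\<Prod>c\<in>Basis. (u - l) \<bullet> c)"
    using le' by (simp add: Basis_vec_def UNION_singleton_eq_range prod.reindex inj_on_def axis_eq_axis inner_axis prod_ennreal)
  finally show "emeasure (distr (Pi\<^sub>M UNIV (\<lambda>_. lborel)) borel ?h) (box l u) = (\<Prod>c\<in>Basis. (u - l) \<bullet> c)" .
qed simp

lemma mem_cvol_body:
  "x \<in> coord_proj I ` K + cbox 0 (\<chi> i. if i \<in> I then 0 else 1)
    \<longleftrightarrow> coord_proj I x \<in> coord_proj I ` K \<and> (\<forall>i. i \<notin> I \<longrightarrow> x $ i \<in> {0..1})"
proof
  assume "x \<in> coord_proj I ` K + cbox 0 (\<chi> i. if i \<in> I then 0 else 1)"
  then obtain k c where x: "x = coord_proj I k + c" "k \<in> K"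
    and c: "c \<in> cbox 0 (\<chi> i. if i \<in> I then 0 else 1)"
    by (auto elim!: set_plus_elim)
  have c': "0 \<le> c $ i" "c $ i \<le> (if i \<in> I then 0 else 1)" for i
    using c by (auto simp: mem_box_cart)
  have "c $ i = 0" if "i \<in> I" for i using c'[of i] that by simp
  then have "coord_proj I x = coord_proj I k" by (auto simp: x coord_proj_def vec_eq_iff)
  moreover have "x $ i \<in> {0..1}" if "i \<notin> I" for i
    using c'[of i] that by (simp add: x coord_proj_def)
  ultimately show "coord_proj I x \<in> coord_proj I ` K \<and> (\<forall>i. i \<notin> I \<longrightarrow> x $ i \<in> {0..1})"
    using x by blast
next
  assume x: "coord_proj I x \<in> coord_proj I ` K \<and> (\<forall>i. i \<notin> I \<longrightarrow> x $ i \<in> {0..1})"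
  then have "coord_proj I x + (x - coord_proj I x) \<in> coord_proj I ` K + cbox 0 (\<chi> i. if i \<in> I then 0 else 1)"
    by (intro set_plus_intro) (auto simp: mem_box_cart coord_proj_def)
  then show "x \<in> coord_proj I ` K + cbox 0 (\<chi> i. if i \<in> I then 0 else 1)" by simp
qed

text \<open>Splitting the coordinates into \<open>I\<close> and \<open>- I\<close> identifies the
  fattened projection with the product of \<open>B\<close> and a unit cube \<open>C\<close>. The
  cube has measure 1, so the product measure of the body is the measure of \<open>B\<close>.\<close>

lemma coord_vol_coord_proj:
  fixes K :: "(real^'n::finite) set"
  assumes K: "compact K"
  shows "coord_vol I (coord_proj I ` K) = cvol I K"
proof -
  interpret product_sigma_finite "\<lambda>_::'n. lborel :: real measure" ..
  interpret J: finite_product_sigma_finite "\<lambda>_::'n. lborel :: real measure" "- I" by standard auto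
  define P where "P J = (Pi\<^sub>M J (\<lambda>_::'n. lborel :: real measure))" for J
  let ?h = "\<lambda>f. (\<chi> i. f i) :: real^'n"
  let ?body = "coord_proj I ` K + cbox 0 (\<chi> i. if i \<in> I then 0 else 1)"
  define B where "B = (\<lambda>x. \<lambda>i\<in>I. x $ i) ` coord_proj I ` K"
  define C where "C = Pi\<^sub>E (- I) (\<lambda>_. {0..1::real})"
  have space_P: "space (P J) = Pi\<^sub>E J (\<lambda>_. UNIV)" for J by (simp add: P_def space_PiM)
  \<comment> \<open>The image is rewritten as a preimage of a compact set under a measurable map,
    which yields its measurability.\<close>
  have B: "B = (\<lambda>f. \<chi> i. if i \<in> I then f i else 0) -` (coord_proj I ` K) \<inter> space (P I)"
  proof (intro equalityI subsetI)
    fix f assume "f \<in> B"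
    then obtain k where k: "f = (\<lambda>i\<in>I. coord_proj I k $ i)" "k \<in> K" by (auto simp: B_def)
    have "(\<chi> i. if i \<in> I then f i else 0) = coord_proj I k"
      by (auto simp: k coord_proj_def vec_eq_iff)
    then show "f \<in> (\<lambda>f. \<chi> i. if i \<in> I then f i else 0) -` (coord_proj I ` K) \<inter> space (P I)"
      using k by (auto simp: space_P)
  next
    fix f assume f: "f \<in> (\<lambda>f. \<chi> i. if i \<in> I then f i else 0) -` (coord_proj I ` K) \<inter> space (P I)"
    then have "f = (\<lambda>i\<in>I. (\<chi> i. if i \<in> I then f i else 0) $ i)"
      by (auto simp: space_P PiE_def extensional_def)
    then show "f \<in> B" using f unfolding B_def by blast
  qed
  have "compact (coord_proj I ` K)" by (intro compact_continuous_image continuous_on_coord_proj K)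
  then have B_meas: "B \<in> sets (P I)"
    unfolding B P_def by (intro measurable_sets[OF measurable_vec_lambda_PiM]) (simp add: borel_compact)
  have C_meas: "C \<in> sets (P (- I))"
    unfolding C_def P_def by (intro sets_PiM_I_finite) auto
  have C_measure: "emeasure (P (- I)) C = 1"
    unfolding C_def P_def by (subst emeasure_PiM) auto
  have body_meas: "?body \<in> sets borel"
    by (rule borel_compact[OF compact_cvol_body[OF K]])
  have meas: "?h \<in> P UNIV \<rightarrow>\<^sub>M borel"
    using measurable_vec_lambda_PiM[of UNIV] by (simp add: P_def)
  have merge: "distr (P I \<Otimes>\<^sub>M P (- I)) (P UNIV) (merge I (- I)) = P UNIV"
    using distr_merge[of I "- I"] by (simp add: P_def)
  have merge_meas: "merge I (- I) \<in> P I \<Otimes>\<^sub>M P (- I) \<rightarrow>\<^sub>M P UNIV"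
    using measurable_merge[of I "- I" "\<lambda>_. lborel :: real measure"] by (simp add: P_def)
  have vimage: "merge I (- I) -` (?h -` ?body \<inter> space (P UNIV)) \<inter> space (P I \<Otimes>\<^sub>M P (- I)) = B \<times> C"
  proof (intro set_eqI)
    fix z :: "('n \<Rightarrow> real) \<times> ('n \<Rightarrow> real)"
    obtain f g where z: "z = (f, g)" by (cases z)
    have "coord_proj I (?h (merge I (- I) (f, g))) = (\<chi> i. if i \<in> I then f i else 0)"
      by (auto simp: coord_proj_def merge_def vec_eq_iff)
    then show "z \<in> merge I (- I) -` (?h -` ?body \<inter> space (P UNIV)) \<inter> space (P I \<Otimes>\<^sub>M P (- I)) \<longleftrightarrow> z \<in> B \<times> C"
      by (auto simp: z B C_def mem_cvol_body space_pair_measure space_P PiE_def Pi_iff merge_def)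
  qed
  have "emeasure lborel ?body = emeasure (distr (P UNIV) borel ?h) ?body"
    unfolding P_def lborel_vec_PiM ..
  also have "\<dots> = emeasure (P UNIV) (?h -` ?body \<inter> space (P UNIV))"
    by (rule emeasure_distr[OF meas body_meas])
  also have "\<dots> = emeasure (distr (P I \<Otimes>\<^sub>M P (- I)) (P UNIV) (merge I (- I))) (?h -` ?body \<inter> space (P UNIV))"
    by (simp only: merge)
  also have "\<dots> = emeasure (P I \<Otimes>\<^sub>M P (- I)) (B \<times> C)"
    by (subst emeasure_distr[OF merge_meas measurable_sets[OF meas body_meas]]) (simp only: vimage)
  also have "\<dots> = emeasure (P I) B * emeasure (P (- I)) C"
    using B_meas C_meas unfolding P_def by (intro J.emeasure_pair_measure_Times) auto
  finally have "emeasure lborel ?body = emeasure (P I) B" by (simp add: C_measure)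
  then have "measure lborel ?body = measure (P I) B" by (simp add: measure_def)
  then show ?thesis
    using body_meas by (simp add: cvol_def coord_vol_def B_def P_def measure_completion)
qed

section \<open>Zonoids as limits of zonotopes\<close>

lemma cball_add_mono:
  fixes K :: "'a::real_normed_vector set"
  assumes "K \<subseteq> cball 0 R" "norm u \<le> r"
  shows "K + closed_segment 0 u \<subseteq> cball 0 (R + r)"
proof
  fix x assume "x \<in> K + closed_segment 0 u"
  then obtain k v where x: "x = k + v" "k \<in> K" "v \<in> closed_segment 0 u" by (auto elim!: set_plus_elim)
  have "norm v \<le> norm u" using segment_bound(1)[OF x(3)] by simp
  then show "x \<in> cball 0 (R + r)"
    using x assms norm_triangle_ineq[of k v] by (auto simp: subset_iff)
qed

text \<open>Segments are added one at a time. The volume is affine in the length \<open>e\<close>,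
  and its slope is the gain at length 1, bounded by the volume of a ball; every segment enlarges the
  enclosing radius by at most 1, hence \<open>R + card J\<close>.\<close>

lemma measure_plus_zono_le:
  fixes K :: "(real^'n::finite) set" and e R :: real
  assumes "finite J" and e: "0 \<le> e" "e \<le> 1"
    and K: "convex K" "compact K" "K \<subseteq> cball 0 R"
  shows "measure lebesgue (K + zono J (\<lambda>j. e *\<^sub>R axis j 1))
    \<le> measure lebesgue K + card J * e * measure lebesgue (cball (0::real^'n) (R + card J))"
  using assms(1) K
proof (induction J arbitrary: K R)
  case empty then show ?case by (simp add: zono_def set_zero)
next
  case (insert j J)
  let ?C = "\<lambda>R. measure lebesgue (cball (0::real^'n) R)"
  let ?a = "axis j 1 :: real^'n"
  have mono: "?C R \<le> ?C R'" if "R \<le> R'" for R R'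
    using that by (intro measure_mono_fmeasurable) (auto intro: fmeasurableD)
  have sub: "K + closed_segment 0 (s *\<^sub>R ?a) \<subseteq> cball 0 (R + 1)" if "0 \<le> s" "s \<le> 1" for s
    using that by (intro cball_add_mono insert.prems) (auto simp: norm_axis_1)
  have "measure lebesgue (K + closed_segment 0 (e *\<^sub>R ?a))
      = measure lebesgue K + e * (measure lebesgue (K + closed_segment 0 (1 *\<^sub>R ?a)) - measure lebesgue K)"
    by (rule measure_plus_segment_affine[OF insert.prems(1,2) e(1)])
  also have "\<dots> \<le> measure lebesgue K + e * ?C (R + 1)"
  proof -
    have "measure lebesgue (K + closed_segment 0 (1 *\<^sub>R ?a)) \<le> ?C (R + 1)"
      using insert.prems sub[of 1]
      by (intro measure_mono_fmeasurable) (auto intro!: fmeasurableD lmeasurable_compact compact_set_plus)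
    then have "measure lebesgue (K + closed_segment 0 (1 *\<^sub>R ?a)) - measure lebesgue K \<le> ?C (R + 1)"
      using measure_nonneg[of lebesgue K] by linarith
    then show ?thesis using e by (simp add: mult_left_mono)
  qed
  finally have step: "measure lebesgue (K + closed_segment 0 (e *\<^sub>R ?a)) \<le> measure lebesgue K + e * ?C (R + 1)" .
  have "K + zono (insert j J) (\<lambda>j. e *\<^sub>R axis j 1)
      = (K + closed_segment 0 (e *\<^sub>R ?a)) + zono J (\<lambda>j. e *\<^sub>R axis j 1)"
    using insert.hyps by (simp add: zono_def add.assoc)
  also have "measure lebesgue \<dots> \<le> measure lebesgue (K + closed_segment 0 (e *\<^sub>R ?a)) + card J * e * ?C (R + 1 + card J)"
    using insert.prems e sub[of e]
    by (intro insert.IH) (auto intro!: compact_set_plus convex_set_plus)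
  also have "\<dots> \<le> measure lebesgue K + e * ?C (R + 1) + card J * e * ?C (R + 1 + card J)"
    using step by simp
  also have "\<dots> \<le> measure lebesgue K + e * ?C (R + 1 + card J) + card J * e * ?C (R + 1 + card J)"
    using mult_left_mono[OF mono[of "R + 1" "R + 1 + card J"] e(1)] by simp
  also have "\<dots> = measure lebesgue K + card (insert j J) * e * ?C (R + card (insert j J))"
    using insert.hyps by (simp add: algebra_simps)
  finally show ?case .
qed

text \<open>Encloses the ball in a cube, which is a translated sum of n segments of length
  \<open>2 * e\<close>, so that a neighbourhood can be estimated by adding segments.\<close>

lemma cball_subset_zono:
  assumes e: "0 < e"
  shows "cball 0 e \<subseteq> (+) (- (\<chi> i. e)) ` zono UNIV (\<lambda>j. (2 * e) *\<^sub>R axis j 1 :: real^'n::finite)"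
proof
  fix x :: "real^'n" assume "x \<in> cball 0 e"
  then have "\<bar>x $ i\<bar> \<le> e" for i using component_le_norm_cart[of x i] by simp
  then have x: "- e \<le> x $ i" "x $ i \<le> e" for i by (simp_all add: abs_le_iff minus_le_iff)
  define y :: "real^'n" where "y = (\<chi> i. (x $ i + e) / (2 * e))"
  have "y \<in> cbox 0 (\<chi> i. if i \<in> UNIV then 1 else 0)"
  proof -
    have "0 \<le> (x $ i + e) / (2 * e)" "(x $ i + e) / (2 * e) \<le> 1" for i
      using x[of i] e by (auto simp: divide_le_eq)
    then show ?thesis by (simp add: y_def mem_box_cart)
  qed
  then have "(2 * e) *\<^sub>R y \<in> (*\<^sub>R) (2 * e) ` zono UNIV (\<lambda>j. axis j 1)"
    unfolding cbox_eq_sum_segments by blast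
  then have "(2 * e) *\<^sub>R y \<in> zono UNIV (\<lambda>j. (2 * e) *\<^sub>R axis j 1)"
    by (simp add: linear_image_zono linear_scaleR)
  moreover have "x = - (\<chi> i. e) + (2 * e) *\<^sub>R y"
    using e by (simp add: y_def vec_eq_iff)
  ultimately show "x \<in> (+) (- (\<chi> i. e)) ` zono UNIV (\<lambda>j. (2 * e) *\<^sub>R axis j 1)" by blast
qed

text \<open>A bound linear in \<open>e\<close> with a constant depending only on \<open>R\<close>
  and the dimension. The condition \<open>e \<le> 1 / 2\<close> keeps the segment length
  \<open>2 * e\<close> of the enclosing cube below 1.\<close>

lemma measure_le_of_subset_plus_cball:
  fixes K L :: "(real^'n::finite) set" and e R :: real
  assumes K: "convex K" "compact K" "K \<subseteq> cball 0 R" and L: "compact L"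
    and sub: "L \<subseteq> K + cball 0 e" and e: "0 < e" "e \<le> 1 / 2"
  shows "measure lebesgue L \<le> measure lebesgue K
    + CARD('n) * (2 * e) * measure lebesgue (cball (0::real^'n) (R + CARD('n)))"
proof -
  let ?Z = "zono UNIV (\<lambda>j. (2 * e) *\<^sub>R axis j 1 :: real^'n)"
  have "L \<subseteq> K + (+) (- (\<chi> i. e)) ` ?Z"
    using sub cball_subset_zono[OF e(1), where 'n='n] set_plus_mono2 by blast
  also have "\<dots> = (+) (- (\<chi> i. e)) ` (K + ?Z)"
    by (simp only: translation_eq_plus ac_simps)
  finally have sub': "L \<subseteq> (+) (- (\<chi> i. e)) ` (K + ?Z)" .
  have "(+) (- (\<chi> i. e)) ` (K + ?Z) \<in> lmeasurable"
    by (intro lmeasurable_compact compact_translation compact_set_plus compact_zono K)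
  then have "measure lebesgue L \<le> measure lebesgue ((+) (- (\<chi> i. e)) ` (K + ?Z))"
    using L by (intro measure_mono_fmeasurable sub') (auto intro: fmeasurableD lmeasurable_compact)
  also have "\<dots> = measure lebesgue (K + ?Z)" by (rule measure_translation)
  also have "\<dots> \<le> measure lebesgue K
      + CARD('n) * (2 * e) * measure lebesgue (cball (0::real^'n) (R + CARD('n)))"
    using e by (intro measure_plus_zono_le K) auto
  finally show ?thesis .
qed

text \<open>The two bounds are proved differently, as convexity is given for the approximating
  bodies only. From below, \<open>L\<close> lies in a thin neighbourhood of a convex
  \<open>K k\<close>, whose volume is controlled linearly; from above, \<open>K k\<close> eventually
  enters any open set around the compact \<open>L\<close>.\<close>

lemma measure_convex_tendsto:
  fixes K :: "nat \<Rightarrow> (real^'n::finite) set"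
  assumes K: "\<And>k. convex (K k)" "\<And>k. compact (K k)" and L: "compact L"
    and KL: "\<And>k. K k \<subseteq> L + cball 0 (e k)" and LK: "\<And>k. L \<subseteq> K k + cball 0 (e k)"
    and e: "\<And>k. 0 < e k" "e \<longlonglongrightarrow> 0"
  shows "(\<lambda>k. measure lebesgue (K k)) \<longlonglongrightarrow> measure lebesgue L"
proof (rule order_tendstoI)
  obtain R where R: "L \<subseteq> cball 0 R"
    using compact_imp_bounded[OF L] by (auto simp: bounded_iff subset_iff)
  \<comment> \<open>The ball of radius \<open>R + 1\<close> contains every \<open>K k\<close> with
    \<open>e k < 1 / 2\<close>, so one constant serves for all late k.\<close>
  define C where "C = CARD('n) * 2 * measure lebesgue (cball (0::real^'n) (R + 1 + CARD('n)))"
  have small: "\<forall>\<^sub>F k in sequentially. e k < d" if "0 < d" for d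
    using order_tendstoD(2)[OF e(2) that] .
  fix a assume "a < measure lebesgue L"
  moreover have "(\<lambda>k. C * e k) \<longlonglongrightarrow> 0" using tendsto_mult_right_zero[OF e(2)] .
  ultimately have "\<forall>\<^sub>F k in sequentially. C * e k < measure lebesgue L - a"
    by (intro order_tendstoD(2)) auto
  then show "\<forall>\<^sub>F k in sequentially. a < measure lebesgue (K k)"
    using small[of "1/2", simplified]
  proof eventually_elim
    case (elim k)
    have "K k \<subseteq> cball 0 (R + 1)"
    proof
      fix x assume "x \<in> K k"
      then have "x \<in> L + cball 0 (e k)" using KL by blast
      then obtain y z where yz: "x = y + z" "y \<in> L" "norm z \<le> e k"
        by (elim set_plus_elim) auto
      moreover have "norm y \<le> R" using yz(2) R by auto
      ultimately show "x \<in> cball 0 (R + 1)"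
        using elim norm_triangle_ineq[of y z] by auto
    qed
    from measure_le_of_subset_plus_cball[OF K this L LK e(1)] elim
    have "measure lebesgue L \<le> measure lebesgue (K k) + C * e k"
      by (simp add: C_def mult_ac)
    then show ?case using elim by linarith
  qed
next
  fix a assume a: "measure lebesgue L < a"
  \<comment> \<open>Outer regularity gives an open set of volume below \<open>a\<close>; by
    compactness it contains a whole \<open>d\<close>-neighbourhood of \<open>L\<close>.\<close>
  obtain U where U: "open U" "L \<subseteq> U" "U - L \<in> lmeasurable"
    and less: "emeasure lebesgue (U - L) < ennreal (a - measure lebesgue L)"
    using sets_lebesgue_outer_open[of L "a - measure lebesgue L"] L a
    by (auto simp: lmeasurable_compact fmeasurableD)
  have U_meas: "U \<in> lmeasurable"
    using fmeasurable.Un[OF lmeasurable_compact[OF L] U(3)] U(2) by (simp add: Un_absorb1)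
  have "measure lebesgue (U - L) < a - measure lebesgue L"
    using less U(3) by (simp add: emeasure_eq_measure2 ennreal_less_iff)
  then have "measure lebesgue U < a"
    using measurable_measure_Diff[OF U_meas _ U(2)] L by (simp add: lmeasurable_compact fmeasurableD)
  obtain d where d: "0 < d" "(\<Union>x\<in>L. cball x d) \<subseteq> U"
    using compact_subset_open_imp_cball_epsilon_subset[OF L U(1,2)] by blast
  have "\<forall>\<^sub>F k in sequentially. e k < d"
    using order_tendstoD(2)[OF e(2) d(1)] .
  then show "\<forall>\<^sub>F k in sequentially. measure lebesgue (K k) < a"
  proof eventually_elim
    case (elim k)
    have "K k \<subseteq> U"
    proof
      fix x assume "x \<in> K k"
      then have "x \<in> L + cball 0 (e k)" using KL by blast
      then obtain y z where yz: "x = y + z" "y \<in> L" "norm z \<le> e k"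
        by (elim set_plus_elim) auto
      have "x \<in> cball y d" using elim yz by (auto simp: dist_norm)
      then show "x \<in> U" using d yz by blast
    qed
    then have "measure lebesgue (K k) \<le> measure lebesgue U"
      by (intro measure_mono_fmeasurable U_meas) (auto intro: fmeasurableD lmeasurable_compact K)
    then show ?case using \<open>measure lebesgue U < a\<close> by linarith
  qed
qed

section \<open>Zonotopes, zonoids and their approximation\<close>

lemma zonotope_eq_zono:
  assumes "zonotope Z"
  obtains m :: nat and a :: "'a::euclidean_space" and u where "Z = (+) a ` zono {..<m} u"
  using assms that closed_segment_translate_sum[of "{..<_}"]
  unfolding zonotope_def zono_def by (metis finite_lessThan)

lemma zonotope_zono:
  fixes u :: "'i \<Rightarrow> 'a::euclidean_space"
  assumes "finite M"
  shows "zonotope (zono M u)"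
proof -
  obtain h where "bij_betw h {..<card M} M"
    using ex_bij_betw_nat_finite[OF assms] by (auto simp: atLeast0LessThan)
  then have "zono M u = (\<Sum>i<card M. closed_segment 0 (u (h i)))"
    unfolding zono_def by (rule sum.reindex_bij_betw[symmetric])
  then show ?thesis unfolding zonotope_def by fastforce
qed

lemma zono_nonempty: "zono M (u :: 'i \<Rightarrow> 'a::real_vector) \<noteq> {}"
proof (cases "finite M")
  case True then show ?thesis
    unfolding zono_def by (induction M) (auto simp: set_zero set_plus_def)
qed (simp add: zono_def set_zero)

lemma zonotope_props:
  assumes "zonotope Z"
  shows "compact Z" "convex Z" "Z \<noteq> {}"
  using assms
  by (elim zonotope_eq_zono; simp add: compact_translation compact_zono convex_translation convex_zono zono_nonempty)+

lemma zonotope_imp_zonoid: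
  assumes "zonotope Z"
  shows "zonoid Z"
proof -
  have "hausdorff_dist Z Z = 0"
    using zonotope_props(3)[OF assms] by (simp add: hausdorff_dist_def)
  then show ?thesis
    using assms zonotope_props[OF assms] by (auto simp: zonoid_def intro!: exI[of _ "\<lambda>_. Z"])
qed

lemma subset_plus_cball_hausdorff:
  fixes A B :: "'a::euclidean_space set"
  assumes A: "compact A" "A \<noteq> {}" and B: "compact B" "B \<noteq> {}" and e: "hausdorff_dist A B < e"
  shows "A \<subseteq> B + cball 0 e" "B \<subseteq> A + cball 0 e"
proof -
  have bdd: "bdd_above ((\<lambda>x. infdist x T) ` S)" if "compact S" for S T :: "'a set"
    using that by (intro bounded_imp_bdd_above compact_imp_bounded compact_continuous_image continuous_intros)
  have *: "S \<subseteq> T + cball 0 e"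
    if S: "compact S" and T: "compact T" "T \<noteq> {}" and le: "(SUP x\<in>S. infdist x T) < e" for S T :: "'a set"
  proof
    fix x assume x: "x \<in> S"
    have "infdist x T \<le> (SUP x\<in>S. infdist x T)" by (rule cSUP_upper[OF x bdd[OF S]])
    moreover obtain y where y: "y \<in> T" "infdist x T = dist x y"
      using infdist_attains_inf[OF compact_imp_closed T(2)] T by blast
    ultimately have "norm (x - y) \<le> e" using le by (simp add: dist_norm)
    then have "y + (x - y) \<in> T + cball 0 e" using y by (intro set_plus_intro) auto
    then show "x \<in> T + cball 0 e" by simp
  qed
  show "A \<subseteq> B + cball 0 e" "B \<subseteq> A + cball 0 e"
    using *[OF A(1) B] *[OF B(1) A] e by (auto simp: hausdorff_dist_def)
qed

lemma norm_coord_proj_le: "norm (coord_proj I x) \<le> norm x"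
  by (intro norm_le_componentwise_cart) (simp add: coord_proj_def)

text \<open>Projections do not increase norms, so closeness survives projecting, and adding the same
  set to both sides keeps it.\<close>

lemma cvol_body_plus_cball:
  assumes "A \<subseteq> B + cball 0 e"
  shows "coord_proj I ` A + C \<subseteq> (coord_proj I ` B + C) + cball 0 e"
proof -
  have "coord_proj I ` A \<subseteq> coord_proj I ` B + coord_proj I ` cball 0 e"
    using assms by (simp add: linear_image_set_plus[OF linear_coord_proj, symmetric] image_mono)
  also have "\<dots> \<subseteq> coord_proj I ` B + cball 0 e"
    using order_trans[OF norm_coord_proj_le] by (intro set_plus_mono2) auto
  finally have "coord_proj I ` A + C \<subseteq> (coord_proj I ` B + cball 0 e) + C"
    by (rule set_plus_mono2) simp
  then show ?thesis by (simp add: ac_simps)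
qed

text \<open>A single sequence must work for all \<open>I\<close> at once, because the inequality
  compares several projections of the same body.\<close>

lemma zonoid_cvol_limit:
  fixes A :: "(real^'n::finite) set"
  assumes "zonoid A"
  obtains Z where "\<And>k. zonotope (Z k)" "\<And>I. (\<lambda>k::nat. cvol I (Z k)) \<longlonglongrightarrow> cvol I A"
proof -
  obtain Z where A: "compact A" "A \<noteq> {}" and Z: "\<And>k::nat. zonotope (Z k)"
    and lim: "(\<lambda>k. hausdorff_dist (Z k) A) \<longlonglongrightarrow> 0"
    using assms by (auto simp: zonoid_def)
  \<comment> \<open>The extra summand makes the radius positive and strictly larger than the
    distance, while it still tends to 0.\<close>
  define e where "e k = \<bar>hausdorff_dist (Z k) A\<bar> + inverse (real (Suc k))" for k
  have e: "0 < e k" "hausdorff_dist (Z k) A < e k" for k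
  proof -
    have "0 < inverse (real (Suc k))" by simp
    then show "0 < e k" "hausdorff_dist (Z k) A < e k" unfolding e_def by linarith+
  qed
  have "e \<longlonglongrightarrow> 0"
    unfolding e_def using tendsto_add[OF tendsto_rabs_zero[OF lim] LIMSEQ_inverse_real_of_nat] by simp
  have "(\<lambda>k. cvol I (Z k)) \<longlonglongrightarrow> cvol I A" for I
    unfolding cvol_def
    using subset_plus_cball_hausdorff[OF zonotope_props(1,3)[OF Z] A e(2)]
    by (intro measure_convex_tendsto[where e=e] convex_cvol_body compact_cvol_body zonotope_props Z A
      cvol_body_plus_cball e \<open>e \<longlonglongrightarrow> 0\<close>)
  then show thesis by (rule that[OF Z])
qed

section \<open>Determinant formulas\<close>

text \<open>A permutation moving an index outside \<open>I\<close> picks an off-diagonal zero of a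
  unit row, so only permutations of \<open>I\<close> contribute.\<close>

lemma det_unit_rows:
  fixes A :: "'a::comm_ring_1^'n::finite^'n"
  assumes unit: "\<And>i j. i \<notin> I \<Longrightarrow> A $ i $ j = (if i = j then 1 else 0)"
  shows "det A = (\<Sum>p | p permutes I. of_int (sign p) * (\<Prod>i\<in>I. A $ i $ p i))"
  unfolding det_def
proof (rule sum.mono_neutral_cong_right)
  show "{p. p permutes I} \<subseteq> {p. p permutes UNIV}"
    using permutes_subset by auto
  show "\<forall>p\<in>{p. p permutes UNIV} - {p. p permutes I}. of_int (sign p) * (\<Prod>i\<in>UNIV. A $ i $ p i) = 0"
  proof
    fix p assume p: "p \<in> {p. p permutes UNIV} - {p. p permutes I}"
    then obtain i where "i \<notin> I" "p i \<noteq> i"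
      using permutes_superset[of p UNIV I] by auto
    then have "A $ i $ p i = 0" by (auto simp: unit)
    then have "(\<Prod>i\<in>UNIV. A $ i $ p i) = 0" by (intro prod_zero) auto
    then show "of_int (sign p) * (\<Prod>i\<in>UNIV. A $ i $ p i) = 0" by simp
  qed
  fix p assume "p \<in> {p. p permutes I}"
  then have "p i = i" if "i \<notin> I" for i using that permutes_not_in by fastforce
  then have "(\<Prod>i\<in>UNIV. A $ i $ p i) = (\<Prod>i\<in>I. A $ i $ p i)"
    by (intro prod.mono_neutral_right) (auto simp: unit)
  then show "of_int (sign p) * (\<Prod>i\<in>UNIV. A $ i $ p i) = of_int (sign p) * (\<Prod>i\<in>I. A $ i $ p i)"
    by simp
qed auto

lemma det_unit_rows_singleton:
  fixes A :: "'a::comm_ring_1^'n::finite^'n"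
  assumes "\<And>i j. i \<noteq> a \<Longrightarrow> A $ i $ j = (if i = j then 1 else 0)"
  shows "det A = A $ a $ a"
  using det_unit_rows[of "{a}" A] assms by simp

lemma det_unit_rows_doubleton:
  fixes A :: "'a::comm_ring_1^'n::finite^'n"
  assumes "\<And>i j. i \<noteq> a \<Longrightarrow> i \<noteq> b \<Longrightarrow> A $ i $ j = (if i = j then 1 else 0)" and ab: "a \<noteq> b"
  shows "det A = A $ a $ a * A $ b $ b - A $ a $ b * A $ b $ a"
proof -
  have "id \<noteq> Transposition.transpose a b" using ab by (metis id_apply transpose_apply_first)
  moreover have "{p. p permutes {a, b}} = {id, Transposition.transpose a b}"
    by (auto simp: permutes_doubleton_iff)
  ultimately show ?thesis
    using det_unit_rows[of "{a, b}" A] assms(1) ab by (simp add: sign_swap_id)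
qed

text \<open>The lift (w, 1) to homogeneous coordinates, with the extra coordinate at
  \<open>None\<close>; it turns simplex volumes into determinants of points.\<close>

definition homog :: "real^'d \<Rightarrow> real^('d::finite) option" where
  "homog w = (\<chi> c. case c of None \<Rightarrow> 1 | Some l \<Rightarrow> w $ l)"

lemma homog_nth [simp]: "homog w $ None = 1" "homog w $ Some l = w $ l"
  by (simp_all add: homog_def)

lemma det_homog:
  fixes s :: "'d::finite option \<Rightarrow> real^'d"
  shows "det (\<chi> r c. homog (s c) $ r) = det (\<chi> i j. s (Some j) $ i - s None $ i)"
proof -
  define A where "A = (\<chi> r c. homog (s c) $ r)"
  \<comment> \<open>Right multiplication by \<open>E\<close> subtracts column \<open>None\<close>
    from all other columns. As row \<open>None\<close> of the lifted points is constant 1, it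
    becomes a unit row.\<close>
  define E :: "real^'d option^'d option" where
    "E = (\<chi> k c. if k = c then 1 else if k = None then - 1 else 0)"
  have A: "A $ None $ c = 1" "A $ Some l $ c = s c $ l" for c l by (simp_all add: A_def)
  have "det E = 1"
    by (subst det_unit_rows_singleton[of None]) (auto simp: E_def)
  have AE: "(A ** E) $ r $ c = (if c = None then A $ r $ None else A $ r $ c - A $ r $ None)" for r c
  proof -
    have "(A ** E) $ r $ c = (\<Sum>k\<in>UNIV. A $ r $ k * E $ k $ c)" by (simp add: matrix_matrix_mult_def)
    also have "\<dots> = A $ r $ None * E $ None $ c + (\<Sum>k\<in>range Some. A $ r $ k * E $ k $ c)"
      by (simp add: UNIV_option_conv)
    also have "(\<Sum>k\<in>range Some. A $ r $ k * E $ k $ c) = (\<Sum>k\<in>range Some. if k = c then A $ r $ k else 0)"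
      by (intro sum.cong) (auto simp: E_def)
    also have "\<dots> = (if c = None then 0 else A $ r $ c)"
      by (cases c) auto
    finally show ?thesis by (auto simp: E_def)
  qed
  have "det A = det (A ** E)" by (simp add: det_mul \<open>det E = 1\<close>)
  also have "\<dots> = (\<Sum>p | p permutes range Some. of_int (sign p) * (\<Prod>i\<in>range Some. (A ** E) $ i $ p i))"
  proof (rule det_unit_rows)
    fix i j :: "'d option" assume "i \<notin> range Some"
    then have "i = None" by (cases i) auto
    then show "(A ** E) $ i $ j = (if i = j then 1 else 0)" by (auto simp: AE A)
  qed
  also have "\<dots> = (\<Sum>p | p permutes UNIV. of_int (sign p) * (\<Prod>i\<in>UNIV. (A ** E) $ Some i $ Some (p i)))"
    by (rule sum_permutations_reindex) (auto simp: bij_betw_def)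
  also have "\<dots> = det (\<chi> i j. s (Some j) $ i - s None $ i)"
    by (simp add: det_def AE A)
  finally show ?thesis by (simp add: A_def)
qed

lemma normalized_vol_eq_det:
  fixes \<sigma> :: "'d::finite option \<Rightarrow> real^'d"
  assumes S: "bij_betw \<sigma> UNIV S"
  shows "normalized_vol S = \<bar>det (\<chi> r c. homog (\<sigma> c) $ r)\<bar>"
proof -
  have "inj \<sigma>" and S_eq: "S = range \<sigma>" using S by (auto simp: bij_betw_def)
  have "card S = Suc CARD('d)" using bij_betw_same_card[OF S] by simp
  moreover have "bij_betw (\<lambda>l. \<sigma> (Some l)) UNIV (S - {\<sigma> None})"
  proof -
    have "inj (\<lambda>l. \<sigma> (Some l))"
      using \<open>inj \<sigma>\<close> by (auto simp: inj_def)
    moreover have "\<sigma> ` range Some = S - {\<sigma> None}"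
      using \<open>inj \<sigma>\<close> by (auto simp: S_eq UNIV_option_conv inj_eq)
    ultimately show ?thesis by (simp add: bij_betw_def image_image)
  qed
  ultimately have "measure lebesgue (convex hull S)
      = \<bar>det (\<chi> i j. \<sigma> (Some j) $ i - \<sigma> None $ i)\<bar> / fact CARD('d)"
    by (intro measure_simplex_finite) (auto simp: S_eq)
  then show ?thesis by (simp add: normalized_vol_def det_homog)
qed

section \<open>Ordered tuples versus subsets\<close>

lemma card_bij_betw_UNIV:
  assumes "finite S" "card S = CARD('n::finite)"
  shows "card {s :: 'n \<Rightarrow> 'i. bij_betw s UNIV S} = fact CARD('n)"
proof -
  obtain \<sigma> :: "'n \<Rightarrow> 'i" where \<sigma>: "bij_betw \<sigma> UNIV S"
    using finite_same_card_bij[of "UNIV :: 'n set" S] assms by auto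
  have "bij_betw (\<lambda>p. \<sigma> \<circ> p) {p. p permutes UNIV} {s. bij_betw s UNIV S}"
  proof (rule bij_betw_byWitness[where f'="\<lambda>s. inv \<sigma> \<circ> s"])
    have inj: "inj \<sigma>" and S_eq: "range \<sigma> = S" using \<sigma> by (auto simp: bij_betw_def)
    show "\<forall>p\<in>{p. p permutes UNIV}. inv \<sigma> \<circ> (\<sigma> \<circ> p) = p" using inj by (auto simp: fun_eq_iff)
    show "\<forall>s\<in>{s. bij_betw s UNIV S}. \<sigma> \<circ> (inv \<sigma> \<circ> s) = s"
      using S_eq by (auto simp: fun_eq_iff bij_betw_def intro!: f_inv_into_f)
    show "(\<lambda>p. \<sigma> \<circ> p) ` {p. p permutes UNIV} \<subseteq> {s. bij_betw s UNIV S}"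
      using \<sigma> by (auto intro: bij_betw_trans permutes_bij)
    show "(\<lambda>s. inv \<sigma> \<circ> s) ` {s. bij_betw s UNIV S} \<subseteq> {p. p permutes UNIV}"
    proof safe
      fix s :: "'n \<Rightarrow> 'i" assume "bij_betw s UNIV S"
      then have "bij (inv \<sigma> \<circ> s)"
        using bij_betw_inv_into[OF \<sigma>] by (rule bij_betw_trans)
      then show "(inv \<sigma> \<circ> s) permutes UNIV" by (intro bij_imp_permutes) auto
    qed
  qed
  then have "card {p. p permutes (UNIV :: 'n set)} = card {s :: 'n \<Rightarrow> 'i. bij_betw s UNIV S}"
    by (rule bij_betw_same_card)
  then show ?thesis by (simp add: card_permutations)
qed

text \<open>Each subset is enumerated by n! bijections, on which \<open>g\<close> agrees; all other
  tuples have a repetition and contribute 0.\<close>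

lemma sum_functions_eq_sum_subsets:
  fixes g :: "('n::finite \<Rightarrow> 'i) \<Rightarrow> real"
  assumes M: "finite M"
    and noninj: "\<And>s. \<not> inj s \<Longrightarrow> g s = 0"
    and G: "\<And>S s. S \<subseteq> M \<Longrightarrow> card S = CARD('n) \<Longrightarrow> bij_betw s UNIV S \<Longrightarrow> g s = G S"
  shows "(\<Sum>s\<in>UNIV \<rightarrow>\<^sub>E M. g s) = fact CARD('n) * (\<Sum>S | S \<subseteq> M \<and> card S = CARD('n). G S)"
proof -
  let ?T = "{S. S \<subseteq> M \<and> card S = CARD('n)}"
  let ?F = "{s :: 'n \<Rightarrow> 'i. s \<in> UNIV \<rightarrow>\<^sub>E M \<and> inj s}"
  have fin: "finite (UNIV \<rightarrow>\<^sub>E M :: ('n \<Rightarrow> 'i) set)" using M by (intro finite_PiE) auto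
  have "(\<Sum>s\<in>UNIV \<rightarrow>\<^sub>E M. g s) = (\<Sum>s\<in>?F. g s)"
    using fin noninj by (intro sum.mono_neutral_right) auto
  also have "\<dots> = (\<Sum>S\<in>?T. \<Sum>s\<in>{s \<in> ?F. range s = S}. g s)"
  proof (rule sum.group[symmetric])
    show "range ` ?F \<subseteq> ?T" by (auto simp: card_image)
  qed (use fin M in auto)
  also have "\<dots> = (\<Sum>S\<in>?T. fact CARD('n) * G S)"
  proof (intro sum.cong refl)
    fix S assume S: "S \<in> ?T"
    have eq: "{s \<in> ?F. range s = S} = {s. bij_betw s UNIV S}"
      using S by (auto simp: bij_betw_def)
    have "(\<Sum>s\<in>{s \<in> ?F. range s = S}. g s) = (\<Sum>s\<in>{s \<in> ?F. range s = S}. G S)"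
      using S by (intro sum.cong refl G) (auto simp: bij_betw_def)
    also have "\<dots> = fact CARD('n) * G S"
      unfolding eq using S card_bij_betw_UNIV[where 'n='n, of S] finite_subset[OF _ M] by auto
    finally show "(\<Sum>s\<in>{s \<in> ?F. range s = S}. g s) = fact CARD('n) * G S" .
  qed
  finally show ?thesis by (simp add: sum_distrib_left)
qed

lemma det_noninj:
  fixes v :: "'i \<Rightarrow> 'a::comm_ring_1^'n::finite"
  assumes "\<not> inj s"
  shows "det (\<chi> r c. v (s c) $ r) = 0"
proof -
  obtain a b where "a \<noteq> b" "s a = s b" using assms by (auto simp: inj_def)
  then show ?thesis by (intro det_identical_columns[of a b]) (auto simp: column_def)
qed

lemma measure_zono:
  fixes u :: "'i \<Rightarrow> real^'n::finite"
  assumes M: "finite M"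
  shows "fact CARD('n) * measure lebesgue (zono M u) = (\<Sum>s\<in>UNIV \<rightarrow>\<^sub>E M. \<bar>det (\<chi> r c. u (s c) $ r)\<bar>)"
proof -
  have "(\<Sum>s\<in>UNIV \<rightarrow>\<^sub>E M. \<bar>det (\<chi> r c. u (s c) $ r)\<bar>)
      = fact CARD('n) * (\<Sum>S | S \<subseteq> M \<and> card S = CARD('n). cvol UNIV (zono S u))"
  proof (rule sum_functions_eq_sum_subsets[OF M])
    fix S :: "'i set" and s :: "'n \<Rightarrow> 'i" assume "bij_betw s UNIV S"
    from cvol_parallelepiped[OF this, of u]
    show "\<bar>det (\<chi> r c. u (s c) $ r)\<bar> = cvol UNIV (zono S u)"
      by (simp add: coord_proj_def)
  qed (simp add: det_noninj)
  also have "(\<Sum>S | S \<subseteq> M \<and> card S = CARD('n). cvol UNIV (zono S u)) = measure lebesgue (zono M u)"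
    using cvol_zono[OF M, of UNIV u] by (simp add: cvol_UNIV)
  finally show ?thesis ..
qed

lemma cvol_singleton_zono:
  fixes u :: "'i \<Rightarrow> real^'n::finite"
  assumes M: "finite M"
  shows "cvol {a} (zono M u) = (\<Sum>i\<in>M. \<bar>u i $ a\<bar>)"
proof -
  have single: "cvol {a} (zono {i} u) = \<bar>u i $ a\<bar>" for i
  proof -
    let ?A = "(\<chi> r c. if c \<in> {a} then coord_proj {a} (u i) $ r else axis c 1 $ r) :: real^'n^'n"
    \<comment> \<open>Transposing turns the unit columns of the parallelepiped matrix into unit
      rows.\<close>
    have "det ?A = det (transpose ?A)" by simp
    also have "\<dots> = u i $ a"
      by (subst det_unit_rows_singleton[of a]) (auto simp: transpose_def coord_proj_def axis_def)
    finally show ?thesis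
      using cvol_parallelepiped[of "\<lambda>_. i" "{a}" "{i}" u] by simp
  qed
  have "{S. S \<subseteq> M \<and> card S = card {a}} = (\<lambda>i. {i}) ` M"
    by (auto simp: card_1_singleton_iff)
  then show ?thesis
    by (simp add: cvol_zono[OF M] sum.reindex single)
qed

lemma sum_pairs_eq_sum_subsets:
  fixes f :: "'i \<Rightarrow> 'i \<Rightarrow> real"
  assumes M: "finite M" and diag: "\<And>i. f i i = 0"
    and F: "\<And>i j. i \<noteq> j \<Longrightarrow> f i j = F {i, j}"
  shows "(\<Sum>i\<in>M. \<Sum>j\<in>M. f i j) = 2 * (\<Sum>S | S \<subseteq> M \<and> card S = 2. F S)"
proof -
  let ?T = "{S. S \<subseteq> M \<and> card S = 2}"
  let ?P = "{(i, j). i \<in> M \<and> j \<in> M \<and> i \<noteq> j}"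
  have P: "?P \<subseteq> M \<times> M" by auto
  have "(\<Sum>i\<in>M. \<Sum>j\<in>M. f i j) = (\<Sum>(i, j)\<in>M \<times> M. f i j)"
    by (simp add: sum.cartesian_product)
  also have "\<dots> = (\<Sum>(i, j)\<in>?P. f i j)"
    using M diag by (intro sum.mono_neutral_right) auto
  also have "\<dots> = (\<Sum>S\<in>?T. \<Sum>p\<in>{p \<in> ?P. {fst p, snd p} = S}. f (fst p) (snd p))"
    using M finite_subset[OF P]
    by (subst sum.group) (auto simp: card_insert_if split_def)
  also have "\<dots> = (\<Sum>S\<in>?T. 2 * F S)"
  proof (intro sum.cong refl)
    fix S assume S: "S \<in> ?T"
    then obtain i j where ij: "S = {i, j}" "i \<noteq> j" by (auto simp: card_2_iff)
    have "{p \<in> ?P. {fst p, snd p} = S} = {(i, j), (j, i)}"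
      using S ij by (auto simp: doubleton_eq_iff)
    then show "(\<Sum>p\<in>{p \<in> ?P. {fst p, snd p} = S}. f (fst p) (snd p)) = 2 * F S"
      using ij by (simp add: F insert_commute)
  qed
  finally show ?thesis by (simp add: sum_distrib_left)
qed

lemma cvol_doubleton_zono:
  fixes u :: "'i \<Rightarrow> real^'n::finite"
  assumes M: "finite M" and ab: "a \<noteq> b"
  shows "2 * cvol {a, b} (zono M u) = (\<Sum>i\<in>M. \<Sum>j\<in>M. \<bar>u i $ a * u j $ b - u j $ a * u i $ b\<bar>)"
proof -
  have pair: "cvol {a, b} (zono {i, j} u) = \<bar>u i $ a * u j $ b - u j $ a * u i $ b\<bar>" if "i \<noteq> j" for i j
  proof -
    let ?\<sigma> = "\<lambda>c. if c = a then i else j"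
    let ?A = "(\<chi> r c. if c \<in> {a, b} then coord_proj {a, b} (u (?\<sigma> c)) $ r else axis c 1 $ r) :: real^'n^'n"
    have "bij_betw ?\<sigma> {a, b} {i, j}" using ab that by (auto simp: bij_betw_def)
    moreover have "det ?A = u i $ a * u j $ b - u j $ a * u i $ b"
    proof -
      have "det ?A = det (transpose ?A)" by simp
      also have "\<dots> = u i $ a * u j $ b - u j $ a * u i $ b"
        using ab by (subst det_unit_rows_doubleton[of a b]) (auto simp: transpose_def coord_proj_def axis_def)
      finally show ?thesis .
    qed
    ultimately show ?thesis using cvol_parallelepiped[of ?\<sigma> "{a, b}" "{i, j}" u] by simp
  qed
  have "card {a, b} = 2" using ab by simp
  then show ?thesis
    by (subst cvol_zono[OF M], subst sum_pairs_eq_sum_subsets[OF M, where F="\<lambda>S. cvol {a, b} (zono S u)"])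
      (simp_all add: pair)
qed

section \<open>Vertices and facets of the unit cube\<close>

lemma finite_cube_vertices: "finite (cube_vertices :: (real^'d::finite) set)"
proof (rule finite_subset)
  show "(cube_vertices :: (real^'d) set) \<subseteq> vec_lambda ` (UNIV \<rightarrow>\<^sub>E {0, 1})"
  proof
    fix v :: "real^'d" assume "v \<in> cube_vertices"
    then show "v \<in> vec_lambda ` (UNIV \<rightarrow>\<^sub>E {0, 1})"
      by (intro image_eqI[of _ _ "\<lambda>i. v $ i"]) (auto simp: cube_vertices_def)
  qed
qed (intro finite_imageI finite_PiE; simp)

text \<open>The facets of a polyhedron are its intersections with the bounding hyperplanes of an
  irredundant system of half-spaces; for the cube these are the 2d coordinate half-spaces
  \<open>H p\<close>.\<close>

lemma facets_unit_cube:
  fixes Fc :: "'d::finite \<times> bool \<Rightarrow> (real^'d) set"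
  defines "Fc \<equiv> \<lambda>p. cbox 0 1 \<inter> {x. x $ fst p = of_bool (snd p)}"
  shows "bij_betw Fc UNIV {F. F facet_of (cbox 0 1 :: (real^'d) set)}"
proof -
  let ?S = "cbox 0 1 :: (real^'d) set"
  define \<alpha> :: "'d \<times> bool \<Rightarrow> real^'d" where "\<alpha> p = (if snd p then 1 else - 1) *\<^sub>R axis (fst p) 1" for p
  define \<beta> :: "'d \<times> bool \<Rightarrow> real" where "\<beta> p = of_bool (snd p)" for p
  define H where "H p = {x. \<alpha> p \<bullet> x \<le> \<beta> p}" for p
  \<comment> \<open>A point violating the constraint \<open>H p\<close> and no other. It witnesses
    irredundancy and also that \<open>H\<close> is injective.\<close>
  define z :: "'d \<times> bool \<Rightarrow> real^'d" where "z p = (\<chi> k. if k = fst p then (if snd p then 2 else - 1) else 1 / 2)" for p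
  have \<alpha>: "\<alpha> p \<bullet> x = (if snd p then x $ fst p else - x $ fst p)" for p x
    by (simp add: \<alpha>_def inner_axis_axis inner_axis' )
  have z: "z p \<in> H q \<longleftrightarrow> q \<noteq> p" for p q
    by (cases p; cases q) (auto simp: H_def \<alpha> \<beta>_def z_def)
  have inj: "inj H" using z by (metis injI)
  have S_eq: "?S = \<Inter>(range H)"
  proof (intro set_eqI iffI)
    fix x assume "x \<in> \<Inter>(range H)"
    then have "x \<in> H (l, True)" "x \<in> H (l, False)" for l by auto
    then show "x \<in> ?S" by (auto simp: H_def \<alpha> \<beta>_def mem_box_cart)
  qed (auto simp: H_def \<alpha> \<beta>_def mem_box_cart)
  have aff: "affine hull ?S = UNIV"
  proof (rule affine_hull_nonempty_interior)
    have "(\<chi> i. 1 / 2) \<in> box 0 (1 :: real^'d)" by (simp add: mem_box_cart)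
    then show "interior ?S \<noteq> {}" by (auto simp: interior_cbox)
  qed
  have facet: "C facet_of ?S \<longleftrightarrow> (\<exists>h. h \<in> range H \<and> C = ?S \<inter> {x. \<alpha> (inv H h) \<bullet> x = \<beta> (inv H h)})" for C
  proof (rule facet_of_polyhedron_explicit)
    show "?S = affine hull ?S \<inter> \<Inter>(range H)" unfolding aff using S_eq by simp
    fix h assume "h \<in> range H"
    then obtain p where "h = H p" by auto
    then show "\<alpha> (inv H h) \<noteq> 0 \<and> h = {x. \<alpha> (inv H h) \<bullet> x \<le> \<beta> (inv H h)}"
      using inj by (simp add: H_def[symmetric]) (auto simp: \<alpha>_def axis_eq_0_iff)
  next
    fix F' assume F': "F' \<subset> range H"
    then obtain p where p: "H p \<notin> F'" by auto
    have "z p \<in> \<Inter>F'"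
    proof
      fix h assume "h \<in> F'"
      then obtain q where "h = H q" "q \<noteq> p" using F' p by blast
      then show "z p \<in> h" using z by simp
    qed
    moreover have "z p \<notin> ?S" using z[of p p] unfolding S_eq by blast
    moreover have "?S \<subseteq> \<Inter>F'" using F' unfolding S_eq by blast
    ultimately show "?S \<subset> affine hull ?S \<inter> \<Inter>F'" unfolding aff by blast
  qed auto
  have "?S \<inter> {x. \<alpha> p \<bullet> x = \<beta> p} = Fc p" for p
    by (auto simp: Fc_def \<alpha> \<beta>_def)
  then have "C facet_of ?S \<longleftrightarrow> C \<in> range Fc" for C
    using inj by (auto simp: facet)
  moreover have "inj Fc"
  proof (rule injI)
    fix p q assume eq: "Fc p = Fc q"
    \<comment> \<open>The centre of the facet \<open>Fc p\<close>; its remaining coordinates 1/2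
      keep it off every other facet.\<close>
    define c :: "real^'d" where "c = (\<chi> k. if k = fst p then of_bool (snd p) else 1 / 2)"
    have "c \<in> Fc p" by (auto simp: c_def Fc_def mem_box_cart)
    then have "c $ fst q = of_bool (snd q)" unfolding eq by (simp add: Fc_def)
    then show "p = q" by (cases "snd q") (auto simp: c_def prod_eq_iff split: if_splits)
  qed
  ultimately show ?thesis by (auto simp: bij_betw_def)
qed

lemma prod_facets_unit_cube:
  fixes x :: "real^'d::finite \<Rightarrow> real"
  shows "(\<Prod>F | F facet_of (cbox 0 1 :: (real^'d) set). \<Sum>v\<in>F \<inter> cube_vertices. x v)
    = (\<Prod>l\<in>UNIV. (\<Sum>v | v \<in> cube_vertices \<and> v $ l = 0. x v) * (\<Sum>v | v \<in> cube_vertices \<and> v $ l = 1. x v))"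
proof -
  let ?Fc = "\<lambda>p :: 'd \<times> bool. cbox 0 1 \<inter> {x. x $ fst p = of_bool (snd p)} :: (real^'d) set"
  have eq: "?Fc p \<inter> cube_vertices = {v. v \<in> cube_vertices \<and> v $ fst p = of_bool (snd p)}" for p
  proof -
    have "v \<in> cbox 0 1" if "v \<in> cube_vertices" for v :: "real^'d"
      unfolding mem_box_cart
    proof
      fix i have "v $ i \<in> {0, 1}" using that by (simp add: cube_vertices_def)
      then show "(0::real^'d) $ i \<le> v $ i \<and> v $ i \<le> (1::real^'d) $ i" by auto
    qed
    then show ?thesis by auto
  qed
  have "(\<Prod>F | F facet_of (cbox 0 1 :: (real^'d) set). \<Sum>v\<in>F \<inter> cube_vertices. x v)
      = (\<Prod>p\<in>UNIV. \<Sum>v | v \<in> cube_vertices \<and> v $ fst p = of_bool (snd p). x v)"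
    by (subst prod.reindex_bij_betw[OF facets_unit_cube, symmetric]) (simp only: eq)
  also have "\<dots> = (\<Prod>l\<in>UNIV. \<Prod>b\<in>UNIV. \<Sum>v | v \<in> cube_vertices \<and> v $ l = of_bool b. x v)"
    unfolding prod.cartesian_product UNIV_Times_UNIV by (simp add: split_def)
  finally show ?thesis by (simp add: UNIV_bool mult.commute)
qed

section \<open>From cube vertices to arbitrary generators\<close>

text \<open>For weights \<open>y i \<ge> 0\<close> this is (d + 1)! times the volume of the zonotope
  with generators y_i (w_i, 1).\<close>

definition det_sum :: "'i set \<Rightarrow> ('i \<Rightarrow> real) \<Rightarrow> ('i \<Rightarrow> real^'d) \<Rightarrow> real" where
  "det_sum M y w = (\<Sum>s\<in>UNIV \<rightarrow>\<^sub>E M. \<bar>det (\<chi> r c. homog (w (s c)) $ r)\<bar> * (\<Prod>c\<in>(UNIV :: 'd::finite option set). y (s c)))"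

text \<open>With nonnegative weights and \<open>f\<close> the l-th coordinate of the points, this is
  twice the area of the projection of that zonotope to the axes \<open>Some l\<close> and
  \<open>None\<close>.\<close>

definition cross_sum :: "'i set \<Rightarrow> ('i \<Rightarrow> real) \<Rightarrow> ('i \<Rightarrow> real) \<Rightarrow> real" where
  "cross_sum M y f = (\<Sum>i\<in>M. \<Sum>j\<in>M. y i * y j * \<bar>f i - f j\<bar>)"

lemma cross_sum_indicator:
  assumes M: "finite M" and f: "\<And>i. i \<in> M \<Longrightarrow> f i \<in> {0, 1}"
  shows "cross_sum M y f = 2 * ((\<Sum>i | i \<in> M \<and> f i = 0. y i) * (\<Sum>i | i \<in> M \<and> f i = 1. y i))"
proof -
  let ?p = "\<lambda>i. if f i = 0 then y i else 0" and ?q = "\<lambda>i. if f i = 1 then y i else 0"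
  have "cross_sum M y f = (\<Sum>i\<in>M. \<Sum>j\<in>M. ?p i * ?q j + ?q i * ?p j)"
    unfolding cross_sum_def
  proof (intro sum.cong refl)
    fix i j assume "i \<in> M" "j \<in> M"
    then show "y i * y j * \<bar>f i - f j\<bar> = ?p i * ?q j + ?q i * ?p j"
      using f[of i] f[of j] by auto
  qed
  also have "\<dots> = (\<Sum>i\<in>M. ?p i) * (\<Sum>j\<in>M. ?q j) + (\<Sum>i\<in>M. ?q i) * (\<Sum>j\<in>M. ?p j)"
    by (simp add: sum.distrib sum_product)
  also have "(\<Sum>i\<in>M. ?p i) = (\<Sum>i | i \<in> M \<and> f i = 0. y i)"
    using M by (intro sum.mono_neutral_cong_right) auto
  also have "(\<Sum>i\<in>M. ?q i) = (\<Sum>i | i \<in> M \<and> f i = 1. y i)"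
    using M by (intro sum.mono_neutral_cong_right) auto
  finally show ?thesis by simp
qed

text \<open>Passing from the largest level \<open>a\<close> of \<open>f\<close> to the next one \<open>b\<close> splits off \<open>a - b\<close> times
  the indicator of the top level set, and \<open>cross_sum\<close> is additive along this splitting while
  \<open>D\<close> is only subadditive.\<close>

lemma seminorm_le_cross_sum:
  fixes D :: "('i \<Rightarrow> real) \<Rightarrow> real"
  assumes M: "finite M"
    and add: "\<And>f g. D (\<lambda>i. f i + g i) \<le> D f + D g"
    and scale: "\<And>c f. D (\<lambda>i. c * f i) = \<bar>c\<bar> * D f"
    and cong: "\<And>f g. (\<And>i. i \<in> M \<Longrightarrow> f i = g i) \<Longrightarrow> D f = D g"
    and ind: "\<And>f. (\<And>i. i \<in> M \<Longrightarrow> f i \<in> {0, 1}) \<Longrightarrow> D f \<le> C * cross_sum M y f"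
  shows "D f \<le> C * cross_sum M y f"
proof (induction "card (f ` M)" arbitrary: f rule: less_induct)
  case less
  show ?case
  proof (cases "\<exists>c. \<forall>i\<in>M. f i = c")
    case True
    then obtain c where c: "\<And>i. i \<in> M \<Longrightarrow> f i = c" by blast
    have "D f = D (\<lambda>i. c * 1)" using c by (intro cong) auto
    also have "\<dots> = \<bar>c\<bar> * D (\<lambda>_. 1)" by (rule scale)
    \<comment> \<open>The constant 1 is itself 0/1-valued, and its cross sum is 0.\<close>
    also have "\<dots> \<le> \<bar>c\<bar> * (C * cross_sum M y (\<lambda>_. 1))"
      by (intro mult_left_mono ind) auto
    also have "\<dots> = C * cross_sum M y f" using c by (simp add: cross_sum_def)
    finally show ?thesis .
  next
    case False
    define a where "a = Max (f ` M)"
    have ne: "f ` M \<noteq> {}" using False by auto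
    have a: "a \<in> f ` M" "\<And>i. i \<in> M \<Longrightarrow> f i \<le> a"
      unfolding a_def using M ne by auto
    have ne': "f ` M - {a} \<noteq> {}"
    proof
      assume "f ` M - {a} = {}"
      then have "\<forall>i\<in>M. f i = a" by auto
      then show False using False by blast
    qed
    define b where "b = Max (f ` M - {a})"
    have "b \<in> f ` M - {a}" unfolding b_def using M ne' by (intro Max_in) auto
    then have b: "b \<in> f ` M" "b < a" using a by force+
    have le_b: "f i \<le> b" if "i \<in> M" "f i \<noteq> a" for i
      unfolding b_def using that M by (intro Max_ge) auto
    define f' where "f' i = min (f i) b" for i
    define U where "U i = (if f i = a then 1 else 0 :: real)" for i
    have f': "f' ` M = f ` M - {a}"
    proof (intro equalityI subsetI)
      fix t assume "t \<in> f ` M - {a}"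
      then obtain i where "i \<in> M" "t = f i" "f i \<noteq> a" by auto
      then show "t \<in> f' ` M" using le_b[of i] by (auto simp: f'_def min_def intro!: image_eqI[of _ _ i])
    next
      fix t assume "t \<in> f' ` M"
      then obtain i where "i \<in> M" "t = min (f i) b" by (auto simp: f'_def)
      then show "t \<in> f ` M - {a}" using b by (auto simp: min_def)
    qed
    have "card (f' ` M) < card (f ` M)"
      unfolding f' by (rule card_Diff1_less[OF finite_imageI[OF M] a(1)])
    note IH = less[OF this]
    have f: "f i = f' i + (a - b) * U i" if "i \<in> M" for i
      using le_b[OF that] b by (auto simp: f'_def U_def)
    have "D f = D (\<lambda>i. f' i + (a - b) * U i)" by (intro cong f)
    also have "\<dots> \<le> D f' + D (\<lambda>i. (a - b) * U i)" by (rule add)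
    also have "\<dots> = D f' + (a - b) * D U" using b by (simp add: scale)
    also have "\<dots> \<le> C * cross_sum M y f' + (a - b) * (C * cross_sum M y U)"
      using b by (intro add_mono IH mult_left_mono ind) (auto simp: U_def)
    also have "\<dots> = C * (cross_sum M y f' + (a - b) * cross_sum M y U)"
      by (simp add: algebra_simps)
    also have "cross_sum M y f' + (a - b) * cross_sum M y U = cross_sum M y f"
      unfolding cross_sum_def sum_distrib_left sum.distrib[symmetric]
    proof (intro sum.cong refl)
      fix i j assume ij: "i \<in> M" "j \<in> M"
      \<comment> \<open>On \<open>M\<close> both \<open>f'\<close> and \<open>U\<close> are
        nondecreasing functions of \<open>f\<close>, so the two differences never have opposite
        signs and their absolute values add.\<close>
      have "\<bar>f i - f j\<bar> = \<bar>f' i - f' j\<bar> + (a - b) * \<bar>U i - U j\<bar>"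
        using le_b[OF ij(1)] le_b[OF ij(2)] b by (auto simp: f'_def U_def min_def)
      then show "y i * y j * \<bar>f' i - f' j\<bar> + (a - b) * (y i * y j * \<bar>U i - U j\<bar>) = y i * y j * \<bar>f i - f j\<bar>"
        by (simp only: distrib_left mult_ac)
    qed
    finally show ?thesis .
  qed
qed

lemma det_homog_coordinate:
  fixes w :: "'i \<Rightarrow> real^'d::finite" and s :: "'d option \<Rightarrow> 'i"
  shows "det (\<chi> r c. homog (\<chi> k. if k = l then f (s c) else w (s c) $ k) $ r)
    = det (\<chi> r. if r = Some l then (\<chi> c. f (s c)) else (\<chi> c. homog (w (s c)) $ r))"
  by (intro arg_cong[of _ _ det]) (auto simp: vec_eq_iff homog_def split: option.split)

text \<open>The l-th coordinates fill exactly one row, \<open>Some l\<close>, of each matrix. So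
  every determinant is linear in \<open>f\<close>, and a nonnegative combination of absolute values
  of linear forms is a seminorm.\<close>

lemma det_sum_coordinate:
  fixes w :: "'i \<Rightarrow> real^'d::finite" and l :: 'd
  assumes M: "finite M" and y: "\<forall>i\<in>M. 0 \<le> y i"
  defines "D \<equiv> \<lambda>f. det_sum M y (\<lambda>i. \<chi> k. if k = l then f i else w i $ k)"
  shows "D (\<lambda>i. f i + g i) \<le> D f + D g"
    and "D (\<lambda>i. c * f i) = \<bar>c\<bar> * D f"
    and "(\<And>i. i \<in> M \<Longrightarrow> f i = g i) \<Longrightarrow> D f = D g"
proof -
  define \<delta> where "\<delta> f s = det (\<chi> r. if r = Some l then (\<chi> c. f (s c)) else (\<chi> c. homog (w (s c)) $ r))"
    for f and s :: "'d option \<Rightarrow> 'i"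
  have D: "D f = (\<Sum>s\<in>UNIV \<rightarrow>\<^sub>E M. \<bar>\<delta> f s\<bar> * (\<Prod>c\<in>UNIV. y (s c)))" for f
    unfolding D_def det_sum_def det_homog_coordinate \<delta>_def ..
  have \<delta>_add: "\<delta> (\<lambda>i. f i + g i) s = \<delta> f s + \<delta> g s" for s
  proof -
    have "(\<chi> c. f (s c) + g (s c)) = (\<chi> c. f (s c)) + (\<chi> c. g (s c))" by (simp add: vec_eq_iff)
    then show ?thesis unfolding \<delta>_def by (simp only: det_row_add)
  qed
  have \<delta>_scale: "\<delta> (\<lambda>i. c * f i) s = c * \<delta> f s" for s
  proof -
    have "(\<chi> c'. c * f (s c')) = c *s (\<chi> c. f (s c))" by (simp add: vec_eq_iff)
    then show ?thesis unfolding \<delta>_def by (simp only: det_row_mul)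
  qed
  have nonneg: "0 \<le> (\<Prod>c\<in>UNIV. y (s c))" if "s \<in> UNIV \<rightarrow>\<^sub>E M" for s :: "'d option \<Rightarrow> 'i"
    using that y by (intro prod_nonneg) (auto simp: PiE_iff)
  show "D (\<lambda>i. f i + g i) \<le> D f + D g"
    unfolding D sum.distrib[symmetric] distrib_right[symmetric]
    by (intro sum_mono mult_right_mono nonneg) (simp add: \<delta>_add abs_triangle_ineq)
  show "D (\<lambda>i. c * f i) = \<bar>c\<bar> * D f"
    by (simp add: D \<delta>_scale abs_mult sum_distrib_left mult.assoc)
  show "D f = D g" if "\<And>i. i \<in> M \<Longrightarrow> f i = g i"
  proof -
    have "\<delta> f s = \<delta> g s" if s: "s \<in> UNIV \<rightarrow>\<^sub>E M" for s
    proof -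
      have "f (s c) = g (s c)" for c using s \<open>\<And>i. i \<in> M \<Longrightarrow> f i = g i\<close> by (auto simp: PiE_iff)
      then have eq: "(\<chi> c. f (s c)) = (\<chi> c. g (s c))" by simp
      show ?thesis unfolding \<delta>_def eq ..
    qed
    then show ?thesis by (simp add: D)
  qed
qed

text \<open>Statement (b) with opposite facets already paired by coordinate, so that each factor
  matches a cross sum of 0/1 values.\<close>

definition hypercube_ineq :: "'d::finite itself \<Rightarrow> bool" where
  "hypercube_ineq _ \<longleftrightarrow> (\<forall>x :: real^'d \<Rightarrow> real. (\<forall>v\<in>cube_vertices. 0 \<le> x v) \<longrightarrow>
    (\<Sum>S | S \<subseteq> cube_vertices \<and> card S = CARD('d) + 1. normalized_vol S * (\<Prod>v\<in>S. x v))
      * (\<Sum>v\<in>cube_vertices. x v) ^ (CARD('d) - 1)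
      \<le> (\<Prod>l\<in>UNIV. (\<Sum>v | v \<in> cube_vertices \<and> v $ l = 0. x v) * (\<Sum>v | v \<in> cube_vertices \<and> v $ l = 1. x v)))"

lemma det_sum_eq_sum_normalized_vol:
  fixes x :: "real^'d::finite \<Rightarrow> real"
  assumes M: "finite M"
  shows "det_sum M x (\<lambda>v. v)
    = fact (CARD('d) + 1) * (\<Sum>S | S \<subseteq> M \<and> card S = CARD('d) + 1. normalized_vol S * (\<Prod>v\<in>S. x v))"
proof -
  have "det_sum M x (\<lambda>v. v) = fact CARD('d option)
      * (\<Sum>S | S \<subseteq> M \<and> card S = CARD('d option). normalized_vol S * (\<Prod>v\<in>S. x v))"
    unfolding det_sum_def
  proof (rule sum_functions_eq_sum_subsets[OF M])
    fix s :: "'d option \<Rightarrow> real^'d" assume "\<not> inj s"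
    from det_noninj[OF this, of homog]
    show "\<bar>det (\<chi> r c. homog (s c) $ r)\<bar> * (\<Prod>c\<in>UNIV. x (s c)) = 0" by simp
  next
    fix S and s :: "'d option \<Rightarrow> real^'d" assume s: "bij_betw s UNIV S"
    show "\<bar>det (\<chi> r c. homog (s c) $ r)\<bar> * (\<Prod>c\<in>UNIV. x (s c)) = normalized_vol S * (\<Prod>v\<in>S. x v)"
      by (simp only: normalized_vol_eq_det[OF s] prod.reindex_bij_betw[OF s, of x])
  qed
  then show ?thesis by simp
qed

text \<open>Generators over the same point merge and their weights add: the tuples \<open>s\<close>
  lying over a tuple \<open>t\<close> of points sum to a product of sums over the fibres. Points of
  \<open>V\<close> that are not hit get weight 0.\<close>

lemma det_sum_pushforward:
  fixes w :: "'i \<Rightarrow> real^'d::finite"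
  assumes M: "finite M" and V: "finite V" "w ` M \<subseteq> V"
  shows "det_sum M y w = det_sum V (\<lambda>v. \<Sum>i | i \<in> M \<and> w i = v. y i) (\<lambda>v. v)"
proof -
  define \<delta> where "\<delta> s = \<bar>det (\<chi> r c. homog (s c) $ r)\<bar>" for s :: "'d option \<Rightarrow> real^'d"
  let ?F = "UNIV \<rightarrow>\<^sub>E M :: ('d option \<Rightarrow> 'i) set" and ?G = "UNIV \<rightarrow>\<^sub>E V :: ('d option \<Rightarrow> real^'d) set"
  have fin: "finite ?F" "finite ?G" using M V by (auto intro!: finite_PiE)
  have "det_sum M y w = (\<Sum>s\<in>?F. \<delta> (\<lambda>c. w (s c)) * (\<Prod>c\<in>UNIV. y (s c)))"
    by (simp add: det_sum_def \<delta>_def)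
  also have "\<dots> = (\<Sum>t\<in>?G. \<Sum>s\<in>{s \<in> ?F. (\<lambda>c. w (s c)) = t}. \<delta> (\<lambda>c. w (s c)) * (\<Prod>c\<in>UNIV. y (s c)))"
    using V(2) by (intro sum.group[symmetric] fin) (auto simp: PiE_iff)
  also have "\<dots> = (\<Sum>t\<in>?G. \<delta> t * (\<Prod>c\<in>UNIV. \<Sum>i | i \<in> M \<and> w i = t c. y i))"
  proof (intro sum.cong refl)
    fix t assume "t \<in> ?G"
    have "(\<Prod>c\<in>UNIV. \<Sum>i | i \<in> M \<and> w i = t c. y i)
        = (\<Sum>s\<in>(\<Pi>\<^sub>E c\<in>UNIV. {i. i \<in> M \<and> w i = t c}). \<Prod>c\<in>UNIV. y (s c))"
      using M by (subst prod_sum_PiE) auto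
    also have "(\<Pi>\<^sub>E c\<in>UNIV. {i. i \<in> M \<and> w i = t c}) = {s \<in> ?F. (\<lambda>c. w (s c)) = t}"
      by (auto simp: PiE_iff fun_eq_iff)
    finally show "(\<Sum>s\<in>{s \<in> ?F. (\<lambda>c. w (s c)) = t}. \<delta> (\<lambda>c. w (s c)) * (\<Prod>c\<in>UNIV. y (s c)))
        = \<delta> t * (\<Prod>c\<in>UNIV. \<Sum>i | i \<in> M \<and> w i = t c. y i)"
      by (auto simp: sum_distrib_left intro!: sum.cong)
  qed
  finally show ?thesis by (simp add: det_sum_def \<delta>_def)
qed

text \<open>The Hypercube inequality for the weights pushed forward to the vertices. The factor (d +
  1)! accounts for ordered tuples on the left, and 2^d for ordered pairs on the right.\<close>

lemma det_sum_le_cube: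
  fixes w :: "'i \<Rightarrow> real^'d::finite"
  assumes hyp: "hypercube_ineq TYPE('d)" and M: "finite M" and y: "\<forall>i\<in>M. 0 \<le> y i"
    and w: "\<forall>i\<in>M. w i \<in> cube_vertices"
  shows "det_sum M y w * (\<Sum>i\<in>M. y i) ^ (CARD('d) - 1) * 2 ^ CARD('d)
    \<le> fact (CARD('d) + 1) * (\<Prod>l\<in>UNIV. cross_sum M y (\<lambda>i. w i $ l))"
proof -
  let ?V = "cube_vertices :: (real^'d) set"
  define x where "x v = (\<Sum>i | i \<in> M \<and> w i = v. y i)" for v
  have x: "\<forall>v\<in>?V. 0 \<le> x v" unfolding x_def using y by (auto intro!: sum_nonneg)
  have part: "(\<Sum>v | v \<in> ?V \<and> v $ l = t. x v) = (\<Sum>i | i \<in> M \<and> w i $ l = t. y i)" for l t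
  proof -
    have "(\<Sum>v | v \<in> ?V \<and> v $ l = t. x v)
        = (\<Sum>v | v \<in> ?V \<and> v $ l = t. \<Sum>i\<in>{i \<in> {i. i \<in> M \<and> w i $ l = t}. w i = v}. y i)"
      unfolding x_def by (intro sum.cong) auto
    also have "\<dots> = (\<Sum>i | i \<in> M \<and> w i $ l = t. y i)"
      using M finite_cube_vertices w by (intro sum.group) auto
    finally show ?thesis .
  qed
  have total: "(\<Sum>v\<in>?V. x v) = (\<Sum>i\<in>M. y i)"
    unfolding x_def using w by (intro sum.group M finite_cube_vertices) auto
  have cross: "cross_sum M y (\<lambda>i. w i $ l)
      = 2 * ((\<Sum>i | i \<in> M \<and> w i $ l = 0. y i) * (\<Sum>i | i \<in> M \<and> w i $ l = 1. y i))" for l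
    using w by (intro cross_sum_indicator M) (auto simp: cube_vertices_def)
  define A where "A = (\<Sum>S | S \<subseteq> ?V \<and> card S = CARD('d) + 1. normalized_vol S * (\<Prod>v\<in>S. x v))"
  define P where "P = (\<Prod>l\<in>UNIV. (\<Sum>i | i \<in> M \<and> w i $ l = 0. y i) * (\<Sum>i | i \<in> M \<and> w i $ l = 1. y i))"
  define Y where "Y = (\<Sum>i\<in>M. y i) ^ (CARD('d) - 1)"
  define c :: real where "c = fact (CARD('d) + 1)"
  have "det_sum M y w = det_sum ?V x (\<lambda>v. v)"
    unfolding x_def using w by (intro det_sum_pushforward M finite_cube_vertices) auto
  also have "\<dots> = c * A"
    unfolding A_def c_def by (rule det_sum_eq_sum_normalized_vol[OF finite_cube_vertices])
  finally have det_sum: "det_sum M y w = c * A" .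
  have "A * Y \<le> P"
    using hyp[unfolded hypercube_ineq_def, THEN spec, THEN mp, OF x]
    by (simp only: part total A_def P_def Y_def)
  then have "c * 2 ^ CARD('d) * (A * Y) \<le> c * 2 ^ CARD('d) * P"
    by (intro mult_left_mono) (simp_all add: c_def)
  moreover have "(\<Prod>l\<in>UNIV. cross_sum M y (\<lambda>i. w i $ l)) = 2 ^ CARD('d) * P"
    by (simp add: cross P_def prod.distrib)
  ultimately show ?thesis
    by (simp only: det_sum Y_def[symmetric] c_def[symmetric] mult_ac)
qed

text \<open>Induction over the set \<open>J\<close> of coordinates that may take arbitrary values.
  To free coordinate \<open>l\<close>, all others are frozen and the seminorm comparison is applied
  in \<open>l\<close>; its 0/1 case is the induction hypothesis for \<open>w\<close> with the l-th
  coordinate replaced.\<close>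

lemma det_sum_le_cross_sum:
  fixes w :: "'i \<Rightarrow> real^'d::finite"
  assumes hyp: "hypercube_ineq TYPE('d)" and M: "finite M" and y: "\<forall>i\<in>M. 0 \<le> y i"
  shows "det_sum M y w * (\<Sum>i\<in>M. y i) ^ (CARD('d) - 1) * 2 ^ CARD('d)
    \<le> fact (CARD('d) + 1) * (\<Prod>l\<in>UNIV. cross_sum M y (\<lambda>i. w i $ l))"
proof -
  define K where "K = (\<Sum>i\<in>M. y i) ^ (CARD('d) - 1) * 2 ^ CARD('d)"
  have K: "0 \<le> K" unfolding K_def using y by (intro mult_nonneg_nonneg zero_le_power sum_nonneg) auto
  have "det_sum M y w * K \<le> fact (CARD('d) + 1) * (\<Prod>l\<in>UNIV. cross_sum M y (\<lambda>i. w i $ l))"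
    if "\<And>i l. i \<in> M \<Longrightarrow> l \<notin> J \<Longrightarrow> w i $ l \<in> {0, 1}" for J
    using finite[of J] that
  proof (induction J arbitrary: w)
    case empty
    then show ?case
      using det_sum_le_cube[OF hyp M y, of w] by (auto simp: K_def cube_vertices_def mult.assoc)
  next
    case (insert l J)
    let ?W = "\<lambda>f i. \<chi> k. if k = l then f i else w i $ k"
    \<comment> \<open>The right-hand side without its l-th factor, hence a constant as far as the
      l-th coordinates are concerned.\<close>
    define C where "C = fact (CARD('d) + 1) * (\<Prod>k\<in>UNIV - {l}. cross_sum M y (\<lambda>i. w i $ k))"
    have prod: "fact (CARD('d) + 1) * (\<Prod>k\<in>UNIV. cross_sum M y (\<lambda>i. ?W f i $ k)) = C * cross_sum M y f" for f
      by (subst prod.remove[of UNIV l]) (auto simp: C_def intro!: prod.cong)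
    have "det_sum M y (?W (\<lambda>i. w i $ l)) * K \<le> C * cross_sum M y (\<lambda>i. w i $ l)"
    proof (rule seminorm_le_cross_sum[OF M, where D="\<lambda>f. det_sum M y (?W f) * K"])
      show "det_sum M y (?W (\<lambda>i. f i + g i)) * K \<le> det_sum M y (?W f) * K + det_sum M y (?W g) * K" for f g
        using mult_right_mono[OF det_sum_coordinate(1)[OF M y] K] by (simp add: distrib_right)
      show "det_sum M y (?W (\<lambda>i. c * f i)) * K = \<bar>c\<bar> * (det_sum M y (?W f) * K)" for c f
        by (simp add: det_sum_coordinate(2)[OF M y])
      show "det_sum M y (?W f) * K = det_sum M y (?W g) * K" if "\<And>i. i \<in> M \<Longrightarrow> f i = g i" for f g
        using det_sum_coordinate(3)[OF M y, of f g l w] that by simp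
      show "det_sum M y (?W f) * K \<le> C * cross_sum M y f" if f: "\<And>i. i \<in> M \<Longrightarrow> f i \<in> {0, 1}" for f
        using insert.IH[of "?W f"] f insert.prems unfolding prod by auto
    qed
    moreover have "?W (\<lambda>i. w i $ l) i = w i" for i by (simp add: vec_eq_iff)
    ultimately show ?case using prod[of "\<lambda>i. w i $ l"] by (simp only:)
  qed
  from this[of UNIV] show ?thesis by (simp add: K_def mult.assoc)
qed

section \<open>The inequality for arbitrary vectors\<close>

lemma det_scaleR_columns:
  fixes v :: "'i \<Rightarrow> real^'n::finite"
  shows "det (\<chi> r c. (y (s c) *\<^sub>R v (s c)) $ r) = (\<Prod>c\<in>UNIV. y (s c)) * det (\<chi> r c. v (s c) $ r)"
proof -
  have "det (\<chi> r c. (y (s c) *\<^sub>R v (s c)) $ r) = det (transpose (\<chi> r c. (y (s c) *\<^sub>R v (s c)) $ r))"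
    by simp
  also have "transpose (\<chi> r c. (y (s c) *\<^sub>R v (s c)) $ r) = (\<chi> c. y (s c) *s v (s c))"
    by (simp add: transpose_def vec_eq_iff)
  also have "det \<dots> = (\<Prod>c\<in>UNIV. y (s c)) * det (\<chi> c. v (s c))"
    by (rule det_rows_mul)
  also have "(\<chi> c. v (s c)) = transpose (\<chi> r c. v (s c) $ r)"
    by (simp add: transpose_def vec_eq_iff)
  finally show ?thesis by simp
qed

text \<open>The same inequality before dividing by last coordinates: it makes sense when some of
  them vanish, and both sides are continuous in \<open>u\<close>.\<close>

definition vec_ineq :: "'i set \<Rightarrow> ('i \<Rightarrow> real^('d::finite) option) \<Rightarrow> bool" where
  "vec_ineq M u \<longleftrightarrow> (\<Sum>s\<in>UNIV \<rightarrow>\<^sub>E M. \<bar>det (\<chi> r c. u (s c) $ r)\<bar>)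
      * (\<Sum>i\<in>M. \<bar>u i $ None\<bar>) ^ (CARD('d) - 1) * 2 ^ CARD('d)
    \<le> fact (CARD('d) + 1)
      * (\<Prod>l\<in>UNIV. \<Sum>i\<in>M. \<Sum>j\<in>M. \<bar>u i $ Some l * u j $ None - u j $ Some l * u i $ None\<bar>)"

text \<open>Each generator is its last coordinate times a lifted point. The weights are the absolute
  values of the last coordinates, since signs disappear in all the absolute values.\<close>

lemma vec_ineq_nonzero:
  fixes u :: "'i \<Rightarrow> real^('d::finite) option"
  assumes hyp: "hypercube_ineq TYPE('d)" and M: "finite M" and u: "\<And>i. i \<in> M \<Longrightarrow> u i $ None \<noteq> 0"
  shows "vec_ineq M u"
proof -
  define w where "w i = (\<chi> l. u i $ Some l / u i $ None)" for i
  have u_eq: "u i = u i $ None *\<^sub>R homog (w i)" if "i \<in> M" for i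
  proof -
    have "u i $ c = (u i $ None *\<^sub>R homog (w i)) $ c" for c
      using u[OF that] by (cases c) (auto simp: w_def)
    then show ?thesis by (intro vec_eq_iff[THEN iffD2] allI)
  qed
  have "(\<Sum>s\<in>UNIV \<rightarrow>\<^sub>E M. \<bar>det (\<chi> r c. u (s c) $ r)\<bar>) = det_sum M (\<lambda>i. \<bar>u i $ None\<bar>) w"
    unfolding det_sum_def
  proof (intro sum.cong refl)
    fix s :: "'d option \<Rightarrow> 'i" assume s: "s \<in> UNIV \<rightarrow>\<^sub>E M"
    then have "s c \<in> M" for c by (auto simp: PiE_iff)
    then have "u (s c) $ r = (u (s c) $ None *\<^sub>R homog (w (s c))) $ r" for c r
      by (rule arg_cong[OF u_eq, of _ "\<lambda>z. z $ r"])
    then have "(\<chi> r c. u (s c) $ r) = (\<chi> r c. (u (s c) $ None *\<^sub>R homog (w (s c))) $ r)"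
      by (intro Cart_lambda_cong)
    then show "\<bar>det (\<chi> r c. u (s c) $ r)\<bar>
        = \<bar>det (\<chi> r c. homog (w (s c)) $ r)\<bar> * (\<Prod>c\<in>UNIV. \<bar>u (s c) $ None\<bar>)"
      by (simp only: det_scaleR_columns[of "\<lambda>i. u i $ None" s "\<lambda>i. homog (w i)"] abs_mult abs_prod mult.commute)
  qed
  moreover have "cross_sum M (\<lambda>i. \<bar>u i $ None\<bar>) (\<lambda>i. w i $ l)
      = (\<Sum>i\<in>M. \<Sum>j\<in>M. \<bar>u i $ Some l * u j $ None - u j $ Some l * u i $ None\<bar>)" for l
    unfolding cross_sum_def
  proof (intro sum.cong refl)
    fix i j assume ij: "i \<in> M" "j \<in> M"
    have "\<bar>u i $ None\<bar> * \<bar>u j $ None\<bar> * \<bar>w i $ l - w j $ l\<bar>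
        = \<bar>u i $ None * u j $ None * (w i $ l - w j $ l)\<bar>" by (simp add: abs_mult)
    also have "u i $ None * u j $ None * (w i $ l - w j $ l) = u i $ Some l * u j $ None - u j $ Some l * u i $ None"
      using u[OF ij(1)] u[OF ij(2)] by (simp add: w_def right_diff_distrib)
    finally show "\<bar>u i $ None\<bar> * \<bar>u j $ None\<bar> * \<bar>w i $ l - w j $ l\<bar>
        = \<bar>u i $ Some l * u j $ None - u j $ Some l * u i $ None\<bar>" .
  qed
  ultimately show ?thesis
    using det_sum_le_cross_sum[OF hyp M, where y="\<lambda>i. \<bar>u i $ None\<bar>" and w=w]
    by (simp only: vec_ineq_def abs_ge_zero simp_thms Ball_def)
qed

lemma tendsto_det:
  fixes A :: "'b \<Rightarrow> real^'n::finite^'n"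
  assumes "\<And>i j. ((\<lambda>x. A x $ i $ j) \<longlongrightarrow> L $ i $ j) F"
  shows "((\<lambda>x. det (A x)) \<longlongrightarrow> det L) F"
  unfolding det_def by (intro tendsto_intros assms)

lemma vec_ineq:
  fixes u :: "'i \<Rightarrow> real^('d::finite) option"
  assumes hyp: "hypercube_ineq TYPE('d)" and M: "finite M"
  shows "vec_ineq M u"
proof -
  \<comment> \<open>Only vanishing last coordinates are moved, so for \<open>e > 0\<close> all of
    them are nonzero.\<close>
  define v where "v e i = u i + (if u i $ None = 0 then e else 0) *\<^sub>R axis None 1" for e :: real and i
  have lim: "((\<lambda>e. v e i) \<longlongrightarrow> u i) (at_right 0)" for i
    unfolding v_def by (cases "u i $ None = 0") (auto intro!: tendsto_eq_intros)
  have ineq: "vec_ineq M (v e)" if "0 < e" for e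
    using that by (intro vec_ineq_nonzero[OF hyp M]) (auto simp: v_def)
  define L R where "L e = (\<Sum>s\<in>UNIV \<rightarrow>\<^sub>E M. \<bar>det (\<chi> r c. v e (s c) $ r)\<bar>)
      * (\<Sum>i\<in>M. \<bar>v e i $ None\<bar>) ^ (CARD('d) - 1) * 2 ^ CARD('d)"
    and "R e = fact (CARD('d) + 1)
      * (\<Prod>l\<in>UNIV. \<Sum>i\<in>M. \<Sum>j\<in>M. \<bar>v e i $ Some l * v e j $ None - v e j $ Some l * v e i $ None\<bar>)" for e
  have "L e \<le> R e" if "0 < e" for e
    using ineq[OF that] by (simp only: vec_ineq_def L_def R_def)
  then have le: "\<forall>\<^sub>F e in at_right 0. L e \<le> R e"
    by (rule eventually_mono[OF eventually_at_right_less])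
  have "(L \<longlongrightarrow> (\<Sum>s\<in>UNIV \<rightarrow>\<^sub>E M. \<bar>det (\<chi> r c. u (s c) $ r)\<bar>)
      * (\<Sum>i\<in>M. \<bar>u i $ None\<bar>) ^ (CARD('d) - 1) * 2 ^ CARD('d)) (at_right 0)"
    unfolding L_def by (intro tendsto_intros tendsto_det lim)
  moreover have "(R \<longlongrightarrow> fact (CARD('d) + 1)
      * (\<Prod>l\<in>UNIV. \<Sum>i\<in>M. \<Sum>j\<in>M. \<bar>u i $ Some l * u j $ None - u j $ Some l * u i $ None\<bar>)) (at_right 0)"
    unfolding R_def by (intro tendsto_intros lim)
  ultimately show ?thesis
    unfolding vec_ineq_def by (intro tendsto_le[OF _ _ _ le]) auto
qed

section \<open>The equivalence\<close>

lemma zono_ineq: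
  fixes u :: "'i \<Rightarrow> real^('d::finite) option"
  assumes hyp: "hypercube_ineq TYPE('d)" and M: "finite M"
  shows "measure lebesgue (zono M u) * cvol {None} (zono M u) ^ (CARD('d) - 1)
    \<le> (\<Prod>l\<in>UNIV. cvol {Some l, None} (zono M u))"
proof -
  define c :: real where "c = fact (CARD('d) + 1)"
  have c: "0 < c" by (simp add: c_def)
  have pos: "0 < c * 2 ^ CARD('d)" using c by simp
  have vol: "(\<Sum>s\<in>UNIV \<rightarrow>\<^sub>E M. \<bar>det (\<chi> r c. u (s c) $ r)\<bar>) = c * measure lebesgue (zono M u)"
    using measure_zono[OF M, of u] by (simp add: c_def)
  have area: "(\<Sum>i\<in>M. \<Sum>j\<in>M. \<bar>u i $ Some l * u j $ None - u j $ Some l * u i $ None\<bar>)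
      = 2 * cvol {Some l, None} (zono M u)" for l
    by (rule cvol_doubleton_zono[OF M, symmetric]) simp
  have "c * measure lebesgue (zono M u) * cvol {None} (zono M u) ^ (CARD('d) - 1) * 2 ^ CARD('d)
      \<le> c * (\<Prod>l\<in>UNIV. 2 * cvol {Some l, None} (zono M u))"
    using vec_ineq[OF hyp M, of u]
    unfolding vec_ineq_def vol area cvol_singleton_zono[OF M, symmetric] c_def .
  also have "\<dots> = c * 2 ^ CARD('d) * (\<Prod>l\<in>UNIV. cvol {Some l, None} (zono M u))"
    by (simp add: prod.distrib)
  finally have "c * 2 ^ CARD('d) * (measure lebesgue (zono M u) * cvol {None} (zono M u) ^ (CARD('d) - 1))
      \<le> c * 2 ^ CARD('d) * (\<Prod>l\<in>UNIV. cvol {Some l, None} (zono M u))"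
    by (simp only: mult_ac)
  then show ?thesis using pos by (simp only: mult_le_cancel_left_pos)
qed

lemma zonotope_ineq:
  fixes Z :: "(real^('d::finite) option) set"
  assumes hyp: "hypercube_ineq TYPE('d)" and Z: "zonotope Z"
  shows "measure lebesgue Z * cvol {None} Z ^ (CARD('d) - 1) \<le> (\<Prod>l\<in>UNIV. cvol {Some l, None} Z)"
proof -
  obtain m :: nat and a u where "Z = (+) a ` zono {..<m} u" by (rule zonotope_eq_zono[OF Z])
  then show ?thesis
    using zono_ineq[OF hyp, of "{..<m}" u] by (simp only: measure_translation cvol_translation finite_lessThan)
qed

lemma zonoid_ineq:
  fixes A :: "(real^('d::finite) option) set"
  assumes hyp: "hypercube_ineq TYPE('d)" and A: "zonoid A"
  shows "measure lebesgue A * cvol {None} A ^ (CARD('d) - 1) \<le> (\<Prod>l\<in>UNIV. cvol {Some l, None} A)"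
proof -
  obtain Z where Z: "\<And>k. zonotope (Z k)" and lim: "\<And>I. (\<lambda>k::nat. cvol I (Z k)) \<longlonglongrightarrow> cvol I A"
    using A by (elim zonoid_cvol_limit) (rule that)
  show ?thesis
  proof (rule LIMSEQ_le)
    show "(\<lambda>k. measure lebesgue (Z k) * cvol {None} (Z k) ^ (CARD('d) - 1))
        \<longlonglongrightarrow> measure lebesgue A * cvol {None} A ^ (CARD('d) - 1)"
      unfolding cvol_UNIV[symmetric] by (intro tendsto_intros lim)
    show "(\<lambda>k. \<Prod>l\<in>UNIV. cvol {Some l, None} (Z k)) \<longlonglongrightarrow> (\<Prod>l\<in>UNIV. cvol {Some l, None} A)"
      by (intro tendsto_intros lim)
  qed (use zonotope_ineq[OF hyp Z] in auto)
qed

text \<open>The test body has one generator x_v (v, 1) for each vertex v. Its volume, width and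
  projected areas are exactly the first sum, the total weight and the paired facet sums.\<close>

lemma hypercube_ineq_of_zonoid_ineq:
  assumes ineq: "\<And>A :: (real^('d::finite) option) set. zonoid A \<Longrightarrow>
      measure lebesgue A * cvol {None} A ^ (CARD('d) - 1) \<le> (\<Prod>l\<in>UNIV. cvol {Some l, None} A)"
  shows "hypercube_ineq TYPE('d)"
  unfolding hypercube_ineq_def
proof (intro allI impI)
  let ?V = "cube_vertices :: (real^'d) set"
  fix x :: "real^'d \<Rightarrow> real" assume x: "\<forall>v\<in>?V. 0 \<le> x v"
  note V = finite_cube_vertices[where 'd='d]
  define u where "u v = x v *\<^sub>R homog v" for v
  define Z where "Z = zono ?V u"
  have "fact CARD('d option) * measure lebesgue Z = det_sum ?V x (\<lambda>v. v)"
    unfolding Z_def measure_zono[OF V] det_sum_def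
  proof (intro sum.cong refl)
    fix s :: "'d option \<Rightarrow> real^'d" assume "s \<in> UNIV \<rightarrow>\<^sub>E ?V"
    then have "0 \<le> (\<Prod>c\<in>UNIV. x (s c))" using x by (intro prod_nonneg) (auto simp: PiE_iff)
    then show "\<bar>det (\<chi> r c. u (s c) $ r)\<bar> = \<bar>det (\<chi> r c. homog (s c) $ r)\<bar> * (\<Prod>c\<in>UNIV. x (s c))"
      unfolding u_def det_scaleR_columns by (simp add: abs_mult mult.commute)
  qed
  then have "fact (CARD('d) + 1) * measure lebesgue Z = fact (CARD('d) + 1)
      * (\<Sum>S | S \<subseteq> ?V \<and> card S = CARD('d) + 1. normalized_vol S * (\<Prod>v\<in>S. x v))"
    unfolding det_sum_eq_sum_normalized_vol[OF V] by simp
  then have vol: "measure lebesgue Z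
      = (\<Sum>S | S \<subseteq> ?V \<and> card S = CARD('d) + 1. normalized_vol S * (\<Prod>v\<in>S. x v))"
    by (simp only: mult_cancel_left fact_nonzero simp_thms)
  have width: "cvol {None} Z = (\<Sum>v\<in>?V. x v)"
    unfolding Z_def cvol_singleton_zono[OF V] using x by (intro sum.cong) (auto simp: u_def)
  have area: "cvol {Some l, None} Z
      = (\<Sum>v | v \<in> ?V \<and> v $ l = 0. x v) * (\<Sum>v | v \<in> ?V \<and> v $ l = 1. x v)" for l
  proof -
    have "2 * cvol {Some l, None} Z = cross_sum ?V x (\<lambda>v. v $ l)"
      unfolding Z_def cross_sum_def
    proof (subst cvol_doubleton_zono[OF V], simp, intro sum.cong refl)
      fix v w assume vw: "v \<in> ?V" "w \<in> ?V"
      have "u v $ Some l * u w $ None - u w $ Some l * u v $ None = x v * x w * (v $ l - w $ l)"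
        by (simp add: u_def algebra_simps)
      then show "\<bar>u v $ Some l * u w $ None - u w $ Some l * u v $ None\<bar> = x v * x w * \<bar>v $ l - w $ l\<bar>"
        using x vw by (simp add: abs_mult)
    qed
    also have "\<dots> = 2 * ((\<Sum>v | v \<in> ?V \<and> v $ l = 0. x v) * (\<Sum>v | v \<in> ?V \<and> v $ l = 1. x v))"
      by (intro cross_sum_indicator V) (auto simp: cube_vertices_def)
    finally show ?thesis by simp
  qed
  have "zonoid Z" unfolding Z_def by (intro zonotope_imp_zonoid zonotope_zono V)
  from ineq[OF this]
  show "(\<Sum>S | S \<subseteq> ?V \<and> card S = CARD('d) + 1. normalized_vol S * (\<Prod>v\<in>S. x v))
      * (\<Sum>v\<in>?V. x v) ^ (CARD('d) - 1)
    \<le> (\<Prod>l\<in>UNIV. (\<Sum>v | v \<in> ?V \<and> v $ l = 0. x v) * (\<Sum>v | v \<in> ?V \<and> v $ l = 1. x v))"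
    unfolding vol width area .
qed

(* The n = d + 1 coordinates of the ambient space are indexed by 'd option:
   None is the last coordinate, Some l with l in 'd are the first n - 1. *)
theorem mainTheorem5:
  fixes n d :: nat
  assumes "n \<ge> 2" and "d = n - 1" and "CARD('d::finite) = d"
  shows
    "(\<forall>A :: (real ^ 'd option) set. zonoid A \<longrightarrow>
        measure lebesgue A * coord_vol {None} (coord_proj {None} ` A) ^ (n - 2)
          \<le> (\<Prod>l\<in>UNIV. coord_vol {Some l, None} (coord_proj {Some l, None} ` A)))
     \<longleftrightarrow>
     (\<forall>x :: real ^ 'd \<Rightarrow> real. (\<forall>v\<in>cube_vertices. 0 \<le> x v) \<longrightarrow>
        (\<Sum>S | S \<subseteq> cube_vertices \<and> card S = d + 1. normalized_vol S * (\<Prod>v\<in>S. x v))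
          * (\<Sum>v\<in>cube_vertices. x v) ^ (d - 1)
          \<le> (\<Prod>F | F facet_of (cbox 0 1 :: (real ^ 'd) set). \<Sum>v\<in>F \<inter> cube_vertices. x v))"
proof -
  have n: "n - 2 = CARD('d) - 1" and d: "d = CARD('d)" using assms by auto
  \<comment> \<open>Compactness, which is part of \<open>zonoid\<close>, allows passing to fattened
    volumes.\<close>
  have vol: "coord_vol I (coord_proj I ` A) = cvol I A" if "zonoid A" for I and A :: "(real ^ 'd option) set"
    using that by (intro coord_vol_coord_proj) (simp add: zonoid_def)
  have "(\<forall>A :: (real ^ 'd option) set. zonoid A \<longrightarrow>
        measure lebesgue A * coord_vol {None} (coord_proj {None} ` A) ^ (n - 2)
          \<le> (\<Prod>l\<in>UNIV. coord_vol {Some l, None} (coord_proj {Some l, None} ` A)))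
      \<longleftrightarrow> hypercube_ineq TYPE('d)"
    unfolding n using hypercube_ineq_of_zonoid_ineq[where 'd='d] zonoid_ineq[where 'd='d]
    by (auto simp: vol)
  then show ?thesis
    unfolding hypercube_ineq_def prod_facets_unit_cube d .
qed

end
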